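(* Let $\lambda>-\tfrac12$, $\lambda\neq 0$, let $\rho>1$, and let $f$ be analytic inside and on the Bernstein ellipse $\mathcal{E}_\rho$. Then for each $n\ge 0$ the Gegenbauer coefficient $a_n^{\lambda}$ of $f$ satisfies \[ a_n^{\lambda}=\frac{c_{n,\lambda}}{i\pi}\oint_{\mathcal{E}_\rho}\frac{f(z)}{(z\pm\sqrt{z^2-1})^{n+1}}\;{}_2F_1\!\left[\begin{matrix} n+1,\ 1-\lambda\\ n+\lambda+1\end{matrix};\ \frac{1}{(z\pm\sqrt{z^2-1})^{2}}\right]dz, \] where the sign is chosen so that $|z\pm\sqrt{z^2-1}|>1$, the contour is traversed counterclockwise, and \[ c_{n,\lambda}=\frac{\Gamma(\lambda)\Gamma(n+1)}{\Gamma(n+\lambda)}. \]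
   Context: $C_n^{(\lambda)}$ denotes the Gegenbauer polynomial of degree $n$, normalized by $C_n^{(\lambda)}(1)=\Gamma(n+2\lambda)/(n!\,\Gamma(2\lambda))$; these are orthogonal on $[-1,1]$ with weight $(1-x^2)^{\lambda-1/2}$ and $\int_{-1}^1(1-x^2)^{\lambda-1/2}C_m^{(\lambda)}C_n^{(\lambda)}dx=h_n^{(\lambda)}\delta_{mn}$ with $h_n^{(\lambda)}=\frac{2^{1-2\lambda}\pi}{\Gamma(\lambda)^2}\frac{\Gamma(n+2\lambda)}{\Gamma(n+1)(n+\lambda)}$. The Gegenbauer coefficients of $f$ are $a_n^{\lambda}=\frac{1}{h_n^{(\lambda)}}\int_{-1}^1(1-x^2)^{\lambda-1/2}f(x)C_n^{(\lambda)}(x)\,dx$, so that $f=\sum_n a_n^\lambda C_n^{(\lambda)}$. The Bernstein ellipse is $\mathcal{E}_\rho=\{\tfrac12(\rho e^{i\theta}+\rho^{-1}e^{-i\theta}):0\le\theta\le2\pi\}$, $\rho>1$. ${}_2F_1\left[\begin{matrix}a_1,a_2\\ b_1\end{matrix};z\right]=\sum_{k\ge0}\frac{(a_1)_k(a_2)_k}{(b_1)_k}\frac{z^k}{k!}$ is the Gauss hypergeometric function, $(z)_k$ the Pochhammer symbol. *)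

theory Defs
  imports "HOL-Complex_Analysis.Complex_Analysis"
begin

text \<open>Gegenbauer polynomial C_n^(lam)(x), explicit form (DLMF 18.5.10); it satisfies
  C_n^(lam)(1) = Gamma(n+2 lam)/(n! Gamma(2 lam)).\<close>
definition gegenbauer :: "nat \<Rightarrow> real \<Rightarrow> real \<Rightarrow> real" where
  "gegenbauer n lam x =
     (\<Sum>k\<le>n div 2. (-1) ^ k * pochhammer lam (n - k) / (fact k * fact (n - 2 * k))
                      * (2 * x) ^ (n - 2 * k))"

definition gegenbauer_weight :: "real \<Rightarrow> real \<Rightarrow> real" where
  "gegenbauer_weight lam x = (1 - x\<^sup>2) powr (lam - 1/2)"

definition gegenbauer_h :: "nat \<Rightarrow> real \<Rightarrow> real" where
  "gegenbauer_h n lam =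
     2 powr (1 - 2 * lam) * pi / (Gamma lam)\<^sup>2 * Gamma (real n + 2 * lam)
       / (Gamma (real n + 1) * (real n + lam))"

definition gegenbauer_coeff :: "real \<Rightarrow> (complex \<Rightarrow> complex) \<Rightarrow> nat \<Rightarrow> complex" where
  "gegenbauer_coeff lam f n =
     complex_of_real (1 / gegenbauer_h n lam) *
     integral {-1..1} (\<lambda>x::real. complex_of_real (gegenbauer_weight lam x * gegenbauer n lam x)
                                   * f (complex_of_real x))"

definition hyp2F1 :: "complex \<Rightarrow> complex \<Rightarrow> complex \<Rightarrow> complex \<Rightarrow> complex" where
  "hyp2F1 a1 a2 b1 z =
     (\<Sum>k. pochhammer a1 k * pochhammer a2 k / pochhammer b1 k * z ^ k / fact k)"

definition bernstein_ellipse :: "real \<Rightarrow> real \<Rightarrow> complex" where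
  "bernstein_ellipse \<rho> t =
     (complex_of_real \<rho> * cis (2 * pi * t) + complex_of_real (1 / \<rho>) * cis (- (2 * pi * t))) / 2"

definition bernstein_region :: "real \<Rightarrow> complex set" where
  "bernstein_region \<rho> =
     {z. (Re z)\<^sup>2 / ((\<rho> + 1/\<rho>) / 2)\<^sup>2 + (Im z)\<^sup>2 / ((\<rho> - 1/\<rho>) / 2)\<^sup>2 \<le> 1}"

definition joukowski_inv :: "complex \<Rightarrow> complex" where
  "joukowski_inv z =
     (if cmod (z + csqrt (z\<^sup>2 - 1)) > 1 then z + csqrt (z\<^sup>2 - 1) else z - csqrt (z\<^sup>2 - 1))"

definition c_const :: "nat \<Rightarrow> real \<Rightarrow> real" where
  "c_const n lam = Gamma lam * Gamma (real n + 1) / Gamma (real n + lam)"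

end

theory Submission
  imports Defs
begin

text \<open>The Joukowski map \<open>J(w) = (w + 1/w)/2\<close> carries the circle \<open>|w| = \<rho>\<close> to the Bernstein ellipse,
  and the generating function of the Chebyshev polynomials \<open>U\<^sub>k = C\<^sub>k\<^sup>(\<^sup>1\<^sup>)\<close> reads
  \<open>1/(J(w) - x) = 2 \<Sum>\<^sub>k U\<^sub>k(x) w\<^bsup>-k-1\<^esup>\<close> for \<open>x \<in> [-1,1]\<close>. Inserting this in Cauchy's formula expands
  \<open>f\<close> in the \<open>U\<^sub>k\<close>, with contour integrals as coefficients, so that only the moments
  \<open>\<integral> (1-x\<^sup>2)\<^bsup>\<lambda>-1/2\<^esup> C\<^sub>n\<^sup>(\<^sup>\<lambda>\<^sup>) U\<^sub>k dx\<close> are needed. Integration by parts lowers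
  \<open>n\<close> to 0 (raising \<open>\<lambda>\<close>), and for \<open>n = 0\<close> the Gegenbauer differential equation gives
  a recurrence lowering the other index by 2. The moments vanish unless \<open>k = n + 2m\<close>, and then they are
  exactly the coefficients of the hypergeometric series.\<close>

section \<open>Identities for Gegenbauer polynomials\<close>

text \<open>Setting the summands to zero beyond \<open>2 * k \<le> n\<close> lets sums for different
  degrees share one index range, so that identities can be checked term by term.\<close>

definition gegenbauer_term :: "nat \<Rightarrow> real \<Rightarrow> nat \<Rightarrow> real \<Rightarrow> real" where
  "gegenbauer_term n \<mu> k x =
     (if 2 * k \<le> n
      then (-1) ^ k * pochhammer \<mu> (n - k) / (fact k * fact (n - 2 * k)) * (2 * x) ^ (n - 2 * k)
      else 0)"

lemma gegenbauer_eq_sum_terms: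
  assumes "n div 2 \<le> N"
  shows "gegenbauer n \<mu> x = (\<Sum>k\<le>N. gegenbauer_term n \<mu> k x)"
proof -
  have "gegenbauer n \<mu> x = (\<Sum>k\<le>n div 2. gegenbauer_term n \<mu> k x)"
    unfolding gegenbauer_def gegenbauer_term_def by (intro sum.cong) auto
  also have "\<dots> = (\<Sum>k\<le>N. gegenbauer_term n \<mu> k x)"
    using assms by (intro sum.mono_neutral_left) (auto simp: gegenbauer_term_def)
  finally show ?thesis .
qed

text \<open>Follows from (\<mu>)_(m+1) = \<mu> (\<mu>+1)_m; the factor n + 1 - 2k is what the larger
  factorial in degree n + 1 cancels.\<close>

lemma gegenbauer_term_x_mult:
  "2 * \<mu> * x * gegenbauer_term n (\<mu> + 1) k x =
     (real n + 1 - 2 * real k) * gegenbauer_term (Suc n) \<mu> k x"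
proof (cases "2 * k \<le> n")
  case True
  then obtain d where n: "n = 2 * k + d" using le_Suc_ex by blast
  have *: "Suc (2 * k + d) - k = Suc (k + d)" "2 * k + d - k = k + d"
      "Suc (2 * k + d) - 2 * k = Suc d" "2 * k \<le> Suc (2 * k + d)" by auto
  show ?thesis
    unfolding n gegenbauer_term_def * by (simp add: pochhammer_rec divide_simps)
next
  case False
  \<comment> \<open>When n + 1 = 2k the left term is zero by convention but the right one need not
    be; there the factor n + 1 - 2k vanishes.\<close>
  then have "Suc n = 2 * k \<or> \<not> 2 * k \<le> Suc n" by linarith
  then show ?thesis
  proof
    assume "Suc n = 2 * k"
    then have "real n + 1 = 2 * real k" by linarith
    with False show ?thesis by (simp add: gegenbauer_term_def)
  qed (use False in \<open>simp add: gegenbauer_term_def\<close>)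
qed

text \<open>The two terms carry the same power of x, since n - 2k = (n+2) - 2(k+1). The factor k + 1
  and the sign come from \<open>fact (Suc k)\<close> and \<open>(-1) ^ Suc k\<close>.\<close>

lemma gegenbauer_term_shift:
  "\<mu> * gegenbauer_term n (\<mu> + 1) k x = - (real k + 1) * gegenbauer_term (n + 2) \<mu> (Suc k) x"
proof (cases "2 * k \<le> n")
  case True
  then obtain d where n: "n = 2 * k + d" using le_Suc_ex by blast
  have *: "2 * k + d + 2 - Suc k = Suc (k + d)" "2 * k + d - k = k + d"
      "2 * k + d + 2 - 2 * Suc k = d" "2 * Suc k \<le> 2 * k + d + 2" "2 * k + d - 2 * k = d" by auto
  show ?thesis
    unfolding n gegenbauer_term_def * by (simp add: pochhammer_rec divide_simps) (simp add: algebra_simps)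
qed (simp add: gegenbauer_term_def)

text \<open>With m = n - k this is \<mu> (\<mu>+1)_m = (\<mu>+m) (\<mu>)_m: both sides equal
  (\<mu>)_(m+1).\<close>

lemma gegenbauer_term_raise:
  "\<mu> * gegenbauer_term n (\<mu> + 1) k x = (\<mu> + real n - real k) * gegenbauer_term n \<mu> k x"
proof (cases "2 * k \<le> n")
  case True
  then obtain d where n: "n = 2 * k + d" using le_Suc_ex by blast
  have *: "\<mu> * pochhammer (\<mu> + 1) (k + d) = (\<mu> + real (k + d)) * pochhammer \<mu> (k + d)"
    by (metis pochhammer_rec pochhammer_rec')
  show ?thesis
    unfolding n gegenbauer_term_def using * by (simp add: divide_simps) 
qed (simp add: gegenbauer_term_def)

lemma has_field_derivative_gegenbauer_term:
  "(gegenbauer_term (Suc n) \<mu> k has_field_derivative 2 * \<mu> * gegenbauer_term n (\<mu> + 1) k x) (at x)"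
proof (cases "2 * k \<le> n")
  case True
  then obtain d where n: "n = 2 * k + d" using le_Suc_ex by blast
  have *: "Suc (2 * k + d) - k = Suc (k + d)" "2 * k + d - k = k + d" "2 * k + d - 2 * k = d"
      "Suc (2 * k + d) - 2 * k = Suc d" "2 * k \<le> Suc (2 * k + d)" by auto
  have D: "((\<lambda>x. (2 * x) ^ Suc d) has_field_derivative real (Suc d) * (2 * x) ^ d * 2) (at x)"
    by (rule derivative_eq_intros refl | simp del: power_Suc)+
  show ?thesis
    unfolding n gegenbauer_term_def[abs_def] * if_P[OF *(5)] if_P[OF le_add1]
    by (rule DERIV_cong[OF DERIV_cmult[OF D]]) (simp add: pochhammer_rec divide_simps)
next
  case False
  have "gegenbauer_term (Suc n) \<mu> k = (\<lambda>_. if 2 * k \<le> Suc n then (-1) ^ k * pochhammer \<mu> (Suc n - k) / (fact k * fact (Suc n - 2 * k)) else 0)"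
    using False by (auto simp: gegenbauer_term_def fun_eq_iff)
  then show ?thesis using False by (simp add: gegenbauer_term_def)
qed

lemma gegenbauer_0 [simp]: "gegenbauer 0 \<mu> x = 1"
  by (simp add: gegenbauer_def)

lemma gegenbauer_1 [simp]: "gegenbauer (Suc 0) \<mu> x = 2 * \<mu> * x"
  by (simp add: gegenbauer_def)

lemma has_field_derivative_gegenbauer:
  "(gegenbauer (Suc n) \<mu> has_field_derivative 2 * \<mu> * gegenbauer n (\<mu> + 1) x) (at x)"
proof -
  have "gegenbauer (Suc n) \<mu> = (\<lambda>x. \<Sum>k\<le>Suc n. gegenbauer_term (Suc n) \<mu> k x)"
    by (rule ext, rule gegenbauer_eq_sum_terms) simp
  moreover have "gegenbauer n (\<mu> + 1) x = (\<Sum>k\<le>Suc n. gegenbauer_term n (\<mu> + 1) k x)"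
    by (rule gegenbauer_eq_sum_terms) simp
  ultimately show ?thesis
    by (auto intro!: derivative_eq_intros has_field_derivative_gegenbauer_term
             simp: sum_distrib_left simp del: sum.atMost_Suc)
qed


text \<open>The classical x C_N' - C_(N-1)' = N C_N for N = n + 2, with the derivatives written as
  polynomials of parameter \<mu> + 1. On term k the two parts contribute N - 2k and 2k.\<close>

lemma gegenbauer_x_mult:
  "2 * \<mu> * (x * gegenbauer (Suc n) (\<mu> + 1) x - gegenbauer n (\<mu> + 1) x)
     = real (n + 2) * gegenbauer (n + 2) \<mu> x"
proof -
  let ?t = "\<lambda>k. gegenbauer_term (n + 2) \<mu> k x"
  have 1: "gegenbauer (n + 2) \<mu> x = (\<Sum>k\<le>Suc n. ?t k)" by (rule gegenbauer_eq_sum_terms) simp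
  have 2: "2 * \<mu> * x * gegenbauer (Suc n) (\<mu> + 1) x = (\<Sum>k\<le>Suc n. (real n + 2 - 2 * real k) * ?t k)"
    using gegenbauer_term_x_mult[of \<mu> x "Suc n"]
    by (subst gegenbauer_eq_sum_terms[of _ "Suc n"]) (simp_all add: sum_distrib_left add_ac del: sum.atMost_Suc)
  have 3: "2 * \<mu> * gegenbauer n (\<mu> + 1) x = (\<Sum>k\<le>n. - 2 * (real k + 1) * ?t (Suc k))"
    using gegenbauer_term_shift[of \<mu> n _ x]
    by (subst gegenbauer_eq_sum_terms[of _ n])
       (simp_all add: sum_distrib_left mult.assoc del: sum.atMost_Suc, simp add: algebra_simps)
  \<comment> \<open>The factor k kills the summand added at k = 0.\<close>
  have 4: "\<dots> = (\<Sum>k\<le>Suc n. - 2 * real k * ?t k)"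
    by (subst sum.atMost_Suc_shift) (simp add: add_ac)
  have "2 * \<mu> * (x * gegenbauer (Suc n) (\<mu> + 1) x - gegenbauer n (\<mu> + 1) x) =
    (\<Sum>k\<le>Suc n. (real n + 2 - 2 * real k) * ?t k) - (\<Sum>k\<le>Suc n. - 2 * real k * ?t k)"
    unfolding 2[symmetric] 3[symmetric] 4[symmetric] by (simp add: algebra_simps)
  also have "\<dots> = (\<Sum>k\<le>Suc n. real (n + 2) * ?t k)"
    unfolding sum_subtractf[symmetric] by (intro sum.cong) (auto simp: algebra_simps)
  finally show ?thesis unfolding 1 sum_distrib_left .
qed

text \<open>With N = n + 2 and y = C_N this is (1-x^2) y'' - (2\<mu>+1) x y' + N (N+2\<mu>) y = 0,
  the derivatives again replaced by shifted polynomials. Every piece is a combination of the terms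
  of C_N, and the coefficients cancel for each k.\<close>

lemma gegenbauer_ode:
  "4 * \<mu> * (\<mu> + 1) * (1 - x\<^sup>2) * gegenbauer n (\<mu> + 2) x
     - 2 * \<mu> * (2 * \<mu> + 1) * x * gegenbauer (Suc n) (\<mu> + 1) x
     + real (n + 2) * (real (n + 2) + 2 * \<mu>) * gegenbauer (n + 2) \<mu> x = 0"
proof -
  let ?t = "\<lambda>k. gegenbauer_term (n + 2) \<mu> k x"
  have 1: "gegenbauer (n + 2) \<mu> x = (\<Sum>k\<le>Suc n. ?t k)" by (rule gegenbauer_eq_sum_terms) simp
  have two: "\<mu> + 1 + 1 = \<mu> + 2" by simp
  have t2: "2 * \<mu> * x * gegenbauer_term (Suc n) (\<mu> + 1) k x = (real n + 2 - 2 * real k) * ?t k" for k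
    using gegenbauer_term_x_mult[of \<mu> x "Suc n" k] by simp
  have 2: "2 * \<mu> * x * gegenbauer (Suc n) (\<mu> + 1) x = (\<Sum>k\<le>Suc n. (real n + 2 - 2 * real k) * ?t k)"
    using t2 by (subst gegenbauer_eq_sum_terms[of _ "Suc n"]) (simp_all add: sum_distrib_left del: sum.atMost_Suc)
  have t3: "4 * \<mu> * (\<mu> + 1) * x\<^sup>2 * gegenbauer_term n (\<mu> + 2) k x
              = (real n + 1 - 2 * real k) * (real n + 2 - 2 * real k) * ?t k" for k
  proof -
    have "4 * \<mu> * (\<mu> + 1) * x\<^sup>2 * gegenbauer_term n (\<mu> + 2) k x
       = 2 * \<mu> * x * (2 * (\<mu> + 1) * x * gegenbauer_term n (\<mu> + 1 + 1) k x)"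
      unfolding two by (simp add: power2_eq_square algebra_simps)
    also have "\<dots> = (real n + 1 - 2 * real k) * (2 * \<mu> * x * gegenbauer_term (Suc n) (\<mu> + 1) k x)"
      by (simp only: gegenbauer_term_x_mult[of "\<mu> + 1" x n k]) (simp only: ac_simps of_nat_Suc)
    finally show ?thesis unfolding t2 by (simp only: ac_simps)
  qed
  have 3: "4 * \<mu> * (\<mu> + 1) * x\<^sup>2 * gegenbauer n (\<mu> + 2) x
      = (\<Sum>k\<le>Suc n. (real n + 1 - 2 * real k) * (real n + 2 - 2 * real k) * ?t k)"
    unfolding t3[symmetric]
    by (subst gegenbauer_eq_sum_terms[of _ "Suc n"]) (simp_all add: sum_distrib_left del: sum.atMost_Suc)
  \<comment> \<open>Without the factor x^2, term k of y'' has the power of x of term k + 1 of C_N;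
    one shift and one raising relation bring the parameter back to \<mu>.\<close>
  have t4: "4 * \<mu> * (\<mu> + 1) * gegenbauer_term n (\<mu> + 2) k x
              = - 4 * real (Suc k) * (\<mu> + real n + 2 - real (Suc k)) * ?t (Suc k)" for k
  proof -
    have "4 * \<mu> * (\<mu> + 1) * gegenbauer_term n (\<mu> + 2) k x
       = 4 * \<mu> * ((\<mu> + 1) * gegenbauer_term n (\<mu> + 1 + 1) k x)"
      unfolding two by (simp only: mult.assoc)
    also have "\<dots> = - 4 * real (Suc k) * (\<mu> * gegenbauer_term (n + 2) (\<mu> + 1) (Suc k) x)"
      unfolding gegenbauer_term_shift[of "\<mu> + 1" n k x] by simp
    finally show ?thesis unfolding gegenbauer_term_raise by (simp add: add_ac)
  qed
  have "4 * \<mu> * (\<mu> + 1) * gegenbauer n (\<mu> + 2) x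
      = (\<Sum>k\<le>n. - 4 * real (Suc k) * (\<mu> + real n + 2 - real (Suc k)) * ?t (Suc k))"
    unfolding t4[symmetric]
    by (subst gegenbauer_eq_sum_terms[of _ n]) (simp_all add: sum_distrib_left del: sum.atMost_Suc)
  also have "\<dots> = (\<Sum>k\<le>Suc n. - 4 * real k * (\<mu> + real n + 2 - real k) * ?t k)"
    by (subst sum.atMost_Suc_shift) simp
  finally have 4: "4 * \<mu> * (\<mu> + 1) * gegenbauer n (\<mu> + 2) x = \<dots>" .
  have "4 * \<mu> * (\<mu> + 1) * (1 - x\<^sup>2) * gegenbauer n (\<mu> + 2) x
     - 2 * \<mu> * (2 * \<mu> + 1) * x * gegenbauer (Suc n) (\<mu> + 1) x
     + real (n + 2) * (real (n + 2) + 2 * \<mu>) * gegenbauer (n + 2) \<mu> x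
    = 4 * \<mu> * (\<mu> + 1) * gegenbauer n (\<mu> + 2) x - 4 * \<mu> * (\<mu> + 1) * x\<^sup>2 * gegenbauer n (\<mu> + 2) x
     - (2 * \<mu> + 1) * (2 * \<mu> * x * gegenbauer (Suc n) (\<mu> + 1) x)
     + real (n + 2) * (real (n + 2) + 2 * \<mu>) * gegenbauer (n + 2) \<mu> x"
    by (simp add: algebra_simps)
  also have "\<dots> = (\<Sum>k\<le>Suc n. 0)"
    unfolding 1 2 3 4 sum_distrib_left sum_subtractf[symmetric] sum.distrib[symmetric]
    by (intro sum.cong) (auto simp: algebra_simps)
  finally show ?thesis by simp
qed

section \<open>Chebyshev polynomials of the second kind\<close>

lemma gegenbauer_one_rec:
  "gegenbauer (n + 2) 1 x = 2 * x * gegenbauer (Suc n) 1 x - gegenbauer n 1 x"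
proof -
  let ?t = "\<lambda>n k. gegenbauer_term n 1 k x"
  \<comment> \<open>Terms of parameter 2 are eliminated between two of the term relations, which
    leaves relations among terms of parameter 1.\<close>
  have a: "(real n + 2 - real k) * (2 * x * ?t (Suc n) k) = (real n + 2 - 2 * real k) * ?t (n + 2) k" for k
  proof -
    have "(real n + 2 - 2 * real k) * ?t (n + 2) k = 2 * x * gegenbauer_term (Suc n) (1 + 1) k x"
      using gegenbauer_term_x_mult[of 1 x "Suc n" k] by simp
    also have "gegenbauer_term (Suc n) (1 + 1) k x = (real n + 2 - real k) * ?t (Suc n) k"
      using gegenbauer_term_raise[of 1 "Suc n" k x] by simp
    finally show ?thesis by simp
  qed
  have b: "(real n + 1 - real k) * ?t n k = - (real k + 1) * ?t (n + 2) (Suc k)" for k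
    using gegenbauer_term_shift[of 1 n k x] gegenbauer_term_raise[of 1 n k x]
    by (simp add: algebra_simps)
  have 0: "2 * x * ?t (Suc n) 0 = ?t (n + 2) 0" using a[of 0] by simp
  \<comment> \<open>Subtracting b from a gives the recurrence times n + 1 - k, which is nonzero for
    k \<le> n and cancels.\<close>
  have S: "2 * x * ?t (Suc n) (Suc k) - ?t n k = ?t (n + 2) (Suc k)" if "k \<le> n" for k
  proof -
    have "(real n + 1 - real k) * (2 * x * ?t (Suc n) (Suc k) - ?t n k) = (real n + 1 - real k) * ?t (n + 2) (Suc k)"
      using a[of "Suc k"] b[of k] by (simp add: algebra_simps)
    then show ?thesis using that by simp
  qed
  have "2 * x * gegenbauer (Suc n) 1 x - gegenbauer n 1 x =
     2 * x * (\<Sum>k\<le>Suc n. ?t (Suc n) k) - (\<Sum>k\<le>n. ?t n k)"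
    by (simp add: gegenbauer_eq_sum_terms[of "Suc n" "Suc n"] gegenbauer_eq_sum_terms[of n n] del: sum.atMost_Suc)
  also have "\<dots> = ?t (n + 2) 0 + (\<Sum>k\<le>n. ?t (n + 2) (Suc k))"
    unfolding sum.atMost_Suc_shift distrib_left 0 sum_distrib_left
    by (simp add: S sum_subtractf[symmetric])
  also have "\<dots> = gegenbauer (n + 2) 1 x"
    by (subst gegenbauer_eq_sum_terms[of _ "Suc n"]) (simp_all add: sum.atMost_Suc_shift del: sum.atMost_Suc)
  finally show ?thesis by simp
qed

lemma continuous_on_gegenbauer [continuous_intros]:
  "continuous_on S (gegenbauer n \<mu>)"
  unfolding gegenbauer_def[abs_def] by (intro continuous_intros) auto

text \<open>With x = cos t and U_n = C_n^(1), one has U_n sin t = sin((n+1)t) and U_(n+1) = cos t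
  U_n + cos((n+1)t). The second identity shows growth by at most 1 per step and avoids dividing by
  sin t, which vanishes at the endpoints.\<close>

lemma gegenbauer_one_bound:
  assumes "\<bar>x\<bar> \<le> 1"
  shows "\<bar>gegenbauer n 1 x\<bar> \<le> real n + 1"
proof -
  define t where "t = arccos x"
  have x: "x = cos t" using assms by (simp add: t_def)
  have "gegenbauer n 1 x * sin t = sin (real (Suc n) * t) \<and>
        gegenbauer (Suc n) 1 x = cos t * gegenbauer n 1 x + cos (real (Suc n) * t)" for n
  proof (induction n)
    case (Suc n)
    have 1: "gegenbauer (Suc n) 1 x * sin t = sin (real (Suc (Suc n)) * t)"
    proof -
      have "sin (real (Suc (Suc n)) * t) = sin (real (Suc n) * t + t)" by (simp add: algebra_simps)
      also have "\<dots> = gegenbauer n 1 x * sin t * cos t + cos (real (Suc n) * t) * sin t"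
        unfolding sin_add using Suc by simp
      also have "\<dots> = gegenbauer (Suc n) 1 x * sin t"
        using Suc by (simp only:) (simp add: algebra_simps)
      finally show ?thesis by simp
    qed
    have "gegenbauer (Suc (Suc n)) 1 x = 2 * cos t * gegenbauer (Suc n) 1 x - gegenbauer n 1 x"
      using gegenbauer_one_rec[of n x] by (simp add: x)
    also have "\<dots> = cos t * gegenbauer (Suc n) 1 x + (cos t * gegenbauer (Suc n) 1 x - gegenbauer n 1 x)"
      by simp
    also have "cos t * gegenbauer (Suc n) 1 x - gegenbauer n 1 x = cos (real (Suc (Suc n)) * t)"
    proof -
      have "cos t * gegenbauer (Suc n) 1 x - gegenbauer n 1 x =
         cos (real (Suc n) * t) * cos t - (1 - cos t * cos t) * gegenbauer n 1 x"
        using Suc by (simp add: algebra_simps)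
      also have "1 - cos t * cos t = sin t * sin t"
        using sin_cos_squared_add[of t] by (simp add: power2_eq_square)
      also have "sin t * sin t * gegenbauer n 1 x = sin (real (Suc n) * t) * sin t"
        using Suc by (metis mult.commute mult.assoc)
      also have "cos (real (Suc n) * t) * cos t - sin (real (Suc n) * t) * sin t = cos (real (Suc n) * t + t)"
        by (simp only: cos_add)
      finally show ?thesis by (simp add: algebra_simps)
    qed
    finally show ?case using 1 by simp
  qed (simp_all add: x)
  note rec = this
  show ?thesis
  proof (induction n)
    case (Suc n)
    have "\<bar>cos t * gegenbauer n 1 x\<bar> \<le> 1 * \<bar>gegenbauer n 1 x\<bar>"
      unfolding abs_mult by (intro mult_right_mono) auto
    moreover have "\<bar>cos (real (Suc n) * t)\<bar> \<le> 1" by (rule abs_cos_le_one)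
    ultimately have "\<bar>gegenbauer (Suc n) 1 x\<bar> \<le> \<bar>gegenbauer n 1 x\<bar> + 1"
      using rec[of n] by linarith
    then show ?case using Suc by simp
  qed simp
qed

section \<open>Weighted moments\<close>

lemma Gamma_legendre_duplication_real:
  fixes x :: real
  assumes "x > 0"
  shows "Gamma x * Gamma (x + 1/2) = 2 powr (1 - 2 * x) * sqrt pi * Gamma (2 * x)"
proof -
  have "complex_of_real x \<notin> \<int>\<^sub>\<le>\<^sub>0" "complex_of_real x + 1/2 \<notin> \<int>\<^sub>\<le>\<^sub>0"
    using assms by (auto elim!: nonpos_Ints_cases simp: complex_eq_iff)
  note D = Gamma_legendre_duplication[OF this]
  have "complex_of_real (Gamma x * Gamma (x + 1/2)) = Gamma (complex_of_real x) * Gamma (complex_of_real x + 1/2)"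
    by (simp add: Gamma_complex_of_real [symmetric])
  also have "\<dots> = complex_of_real (2 powr (1 - 2 * x) * sqrt pi * Gamma (2 * x))"
    unfolding D by (simp add: Gamma_complex_of_real [symmetric] powr_def exp_of_real [symmetric])
  finally show ?thesis by (simp only: of_real_eq_iff)
qed

text \<open>Legendre duplication at l + 1/2 in Beta form. It converts the symmetric Beta integral
  over [0,1] into the mass of the weight over [-1,1].\<close>

lemma Beta_add_half_same:
  fixes l :: real
  assumes "l > -1/2"
  shows "2 powr (2 * l) * Beta (l + 1/2) (l + 1/2) = Beta (l + 1/2) (1/2)"
proof -
  have "Gamma (l + 1/2) * Gamma (l + 1) = 2 powr (- (2 * l)) * sqrt pi * Gamma (2 * l + 1)"
    using Gamma_legendre_duplication_real[of "l + 1/2"] assms by (simp add: add_ac distrib_left)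
  then have "2 powr (2 * l) * (Gamma (l + 1/2) * Gamma (l + 1)) = sqrt pi * Gamma (2 * l + 1)"
    by (simp add: powr_minus field_simps)
  moreover have "Gamma (l + 1) > 0" "Gamma (2 * l + 1) > 0" using assms by auto
  ultimately show ?thesis
    unfolding Beta_def Gamma_one_half_real
    by (auto simp: frac_eq_eq algebra_simps simp del: distrib_right)
qed

text \<open>The substitution t = (x+1)/2 turns the Beta integrand into a multiple of the weight,
  because 4t(1-t) = 1 - x^2.\<close>

lemma has_integral_gegenbauer_weight:
  assumes "l > -1/2"
  shows "(gegenbauer_weight l has_integral Beta (l + 1/2) (1/2)) {-1..1}"
proof -
  define g where "g = (\<lambda>t. t powr (l - 1/2) * (1 - t) powr (l - 1/2))"
  have "((\<lambda>t. t powr (l + 1/2 - 1) * (1 - t) powr (l + 1/2 - 1)) has_integral Beta (l + 1/2) (l + 1/2)) {0..1}"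
    using assms by (intro has_integral_Beta_real) auto
  then have "(g has_integral Beta (l + 1/2) (l + 1/2)) (cbox 0 1)"
    by (simp add: g_def)
  from has_integral_affinity'[OF this, of "1/2" "1/2"]
  have 1: "((\<lambda>x. g (x / 2 + 1/2)) has_integral 2 * Beta (l + 1/2) (l + 1/2)) {-1..1}"
    by simp
  have "4 powr (l - 1/2) * g (x / 2 + 1/2) = gegenbauer_weight l x" if x: "x \<in> {-1..1}" for x
  proof -
    have "4 powr (l - 1/2) * g (x / 2 + 1/2)
       = (4 * ((x / 2 + 1/2) * (1 - (x / 2 + 1/2)))) powr (l - 1/2)"
      using x unfolding g_def by (subst powr_mult; (subst powr_mult)?) auto
    also have "4 * ((x / 2 + 1/2) * (1 - (x / 2 + 1/2))) = 1 - x\<^sup>2"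
      by (simp add: power2_eq_square algebra_simps)
    finally show ?thesis by (simp add: gegenbauer_weight_def)
  qed
  moreover have "4 powr (l - 1/2) * (2 * Beta (l + 1/2) (l + 1/2)) = Beta (l + 1/2) (1/2)"
  proof -
    have "4 powr (l - 1/2) * 2 = 2 powr (2 * l)"
      using powr_powr[of 2 2 "l - 1/2"] powr_mult_base[of 2 "2 * l - 1"] by (simp add: algebra_simps)
    then show ?thesis using Beta_add_half_same[OF assms] by (metis mult.assoc)
  qed
  ultimately show ?thesis
    using has_integral_cong[THEN iffD1, OF _ has_integral_mult_right[OF 1, of "4 powr (l - 1/2)"]]
    by metis
qed

lemma gegenbauer_weight_nonneg [simp]: "gegenbauer_weight l x \<ge> 0"
  by (simp add: gegenbauer_weight_def)

lemma gegenbauer_weight_Suc: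
  assumes "x \<in> {-1..1}"
  shows "gegenbauer_weight (l + 1) x = (1 - x\<^sup>2) * gegenbauer_weight l x"
proof -
  have "1 - x\<^sup>2 \<ge> 0" using assms by (simp add: abs_square_le_1 abs_le_iff)
  then show ?thesis
    unfolding gegenbauer_weight_def by (subst powr_mult_base) (auto simp: algebra_simps)
qed

text \<open>For l < 1/2 the weight is unbounded near the endpoints, so integrability is obtained
  from an integrable weight times a bounded measurable factor.\<close>

lemma absolutely_integrable_gegenbauer_weight:
  fixes g :: "real \<Rightarrow> 'a::euclidean_space"
  assumes l: "l > -1/2" and g: "continuous_on {-1..1} g"
  shows "(\<lambda>x. gegenbauer_weight l x *\<^sub>R g x) absolutely_integrable_on {-1..1}"
proof -
  have "bilinear (\<lambda>(v::'a) r. r *\<^sub>R v)"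
    by (auto simp: bilinear_def linear_iff algebra_simps)
  moreover have "g \<in> borel_measurable (lebesgue_on {-1..1})"
    using g by (intro continuous_imp_measurable_on_sets_lebesgue) auto
  moreover have "bounded (g ` {-1..1})"
    using g compact_continuous_image compact_imp_bounded by blast
  moreover have "gegenbauer_weight l absolutely_integrable_on {-1..1}"
    using has_integral_gegenbauer_weight[OF l]
    by (intro nonnegative_absolutely_integrable_1) (auto simp: has_integral_integrable)
  ultimately show ?thesis
    using absolutely_integrable_bounded_measurable_product[of "\<lambda>v r. r *\<^sub>R v" g "{-1..1}" "gegenbauer_weight l"]
    by auto
qed

lemma integrable_gegenbauer_weight:
  fixes g :: "real \<Rightarrow> real"
  assumes "l > -1/2" "continuous_on {-1..1} g"
  shows "(\<lambda>x. gegenbauer_weight l x * g x) integrable_on {-1..1}"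
  using absolutely_integrable_gegenbauer_weight[OF assms] by (simp add: absolutely_integrable_on_def)

text \<open>The boundary terms vanish because the antiderivative carries the factor
  \<^term>\<open>(1 - x\<^sup>2) powr (l + 1/2)\<close>.\<close>

lemma has_integral_gegenbauer_weight_by_parts:
  assumes l: "l > -1/2" and p: "\<And>x. (p has_field_derivative p' x) (at x)"
  shows "((\<lambda>x. gegenbauer_weight l x * ((1 - x\<^sup>2) * p' x - (2 * l + 1) * x * p x)) has_integral 0) {-1..1}"
proof -
  define F where "F = (\<lambda>x::real. (1 - x\<^sup>2) powr (l + 1/2) * p x)"
  have cont: "continuous_on {-1..1} F"
  proof -
    have "continuous_on {-1..1} (\<lambda>x::real. (1 - x\<^sup>2) powr (l + 1/2))"
      using l by (intro continuous_on_powr' continuous_intros) (auto simp: abs_square_le_1 abs_le_iff)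
    moreover have "continuous_on {-1..1} p"
      using p by (meson DERIV_isCont continuous_at_imp_continuous_on)
    ultimately show ?thesis unfolding F_def by (rule continuous_on_mult)
  qed
  have "(F has_vector_derivative
          gegenbauer_weight l x * ((1 - x\<^sup>2) * p' x - (2 * l + 1) * x * p x)) (at x)"
    if x: "x \<in> {-1<..<1}" for x
  proof -
    have pos: "1 - x\<^sup>2 > 0" using x by (simp add: abs_square_less_1 abs_less_iff)
    have e: "(1 - x\<^sup>2) powr (l + 1/2) = (1 - x\<^sup>2) * (1 - x\<^sup>2) powr (l - 1/2)"
      using pos by (subst powr_mult_base) (auto simp: add_ac)
    have "(F has_field_derivative
       ((l + 1/2) * (1 - x\<^sup>2) powr (l + 1/2 - 1) * (- 2 * x)) * p x + p' x * (1 - x\<^sup>2) powr (l + 1/2)) (at x)"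
      unfolding F_def using pos
      by (intro DERIV_mult p DERIV_fun_powr) (auto intro!: derivative_eq_intros)
    also have "((l + 1/2) * (1 - x\<^sup>2) powr (l + 1/2 - 1) * (- 2 * x)) * p x + p' x * (1 - x\<^sup>2) powr (l + 1/2)
       = gegenbauer_weight l x * ((1 - x\<^sup>2) * p' x - (2 * l + 1) * x * p x)"
      unfolding e gegenbauer_weight_def by (simp add: algebra_simps)
    finally show ?thesis by (simp add: has_real_derivative_iff_has_vector_derivative)
  qed
  from fundamental_theorem_of_calculus_interior[OF _ cont this]
  show ?thesis by (simp add: F_def)
qed

section \<open>Ladder relations and moments\<close>

text \<open>This is the differential equation for y = C_(n+1)^(l), with y' = 2 l C_n^(l+1) inserted.
  It says that the derivative of (1-x^2)^(l+1/2) y' is a multiple of (1-x^2)^(l-1/2) y. Degree n = 0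
  is separate since \<open>gegenbauer_ode\<close> starts at y of degree 2.\<close>

lemma gegenbauer_lowering:
  assumes "(gegenbauer n (l + 1) has_field_derivative D) (at x)"
  shows "2 * l * ((1 - x\<^sup>2) * D - (2 * l + 1) * x * gegenbauer n (l + 1) x)
     = - real (Suc n) * (real (Suc n) + 2 * l) * gegenbauer (Suc n) l x"
proof (cases n)
  case 0
  then have "D = 0" using assms DERIV_unique[OF assms, of 0] by (simp add: gegenbauer_def[abs_def])
  then show ?thesis using 0 by (simp add: algebra_simps)
next
  case (Suc m)
  have "D = 2 * (l + 1) * gegenbauer m (l + 1 + 1) x"
    using DERIV_unique assms has_field_derivative_gegenbauer unfolding Suc by blast
  then show ?thesis using gegenbauer_ode[of l x m] unfolding Suc
    by (simp add: algebra_simps)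
qed

text \<open>The second polynomial has its own parameter: the moments wanted have parameters l and 1,
  and each lowering of n raises both by one.\<close>

definition gegenbauer_inner :: "nat \<Rightarrow> real \<Rightarrow> nat \<Rightarrow> real \<Rightarrow> real" where
  "gegenbauer_inner n l k \<mu> =
     integral {-1..1} (\<lambda>x. gegenbauer_weight l x * (gegenbauer n l x * gegenbauer k \<mu> x))"

lemma has_integral_gegenbauer_inner:
  assumes "l > -1/2"
  shows "((\<lambda>x. gegenbauer_weight l x * (gegenbauer n l x * gegenbauer k \<mu> x))
            has_integral gegenbauer_inner n l k \<mu>) {-1..1}"
  unfolding gegenbauer_inner_def
  by (intro integrable_integral integrable_gegenbauer_weight assms continuous_intros)

lemma has_field_derivative_gegenbauer_0: "(gegenbauer 0 \<mu> has_field_derivative 0) (at x)"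
  by (simp add: gegenbauer_def[abs_def])

lemma has_field_derivative_deriv_gegenbauer: "(gegenbauer n \<mu> has_field_derivative deriv (gegenbauer n \<mu>) x) (at x)"
  by (cases n) (use has_field_derivative_gegenbauer has_field_derivative_gegenbauer_0 in \<open>metis DERIV_imp_deriv\<close>)+

text \<open>The derivative of (1-x^2)^(l+1/2) C_n^(l+1) G integrates to 0, and the lowering relation
  rewrites the part where G is not differentiated. Using \<open>deriv\<close> keeps the statement
  uniform in k, constants included.\<close>

lemma has_integral_gegenbauer_ladder:
  assumes l: "l > -1/2"
  shows "((\<lambda>x. 2 * l * (gegenbauer_weight (l + 1) x * (gegenbauer n (l + 1) x * deriv (gegenbauer k \<mu>) x)))
           has_integral real (Suc n) * (real (Suc n) + 2 * l) * gegenbauer_inner (Suc n) l k \<mu>) {-1..1}"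
proof -
  let ?C = "gegenbauer n (l + 1)" and ?G = "gegenbauer k \<mu>"
  have "((\<lambda>x. ?C x * ?G x) has_field_derivative deriv ?C x * ?G x + deriv ?G x * ?C x) (at x)" for x
    by (intro DERIV_mult has_field_derivative_deriv_gegenbauer)
  from has_integral_mult_right[OF has_integral_gegenbauer_weight_by_parts[OF l this], of "2 * l"]
  have 1: "((\<lambda>x. 2 * l * (gegenbauer_weight l x * ((1 - x\<^sup>2) * (deriv ?C x * ?G x + deriv ?G x * ?C x)
        - (2 * l + 1) * x * (?C x * ?G x)))) has_integral 0) {-1..1}"
    by simp
  have 2: "((\<lambda>x. real (Suc n) * (real (Suc n) + 2 * l) *
          (gegenbauer_weight l x * (gegenbauer (Suc n) l x * ?G x)))
        has_integral real (Suc n) * (real (Suc n) + 2 * l) * gegenbauer_inner (Suc n) l k \<mu>) {-1..1}"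
    by (intro has_integral_mult_right has_integral_gegenbauer_inner l)
  have 3: "2 * l * (gegenbauer_weight l x * ((1 - x\<^sup>2) * (deriv ?C x * ?G x + deriv ?G x * ?C x)
        - (2 * l + 1) * x * (?C x * ?G x)))
      + real (Suc n) * (real (Suc n) + 2 * l) * (gegenbauer_weight l x * (gegenbauer (Suc n) l x * ?G x))
     = 2 * l * (gegenbauer_weight (l + 1) x * (?C x * deriv ?G x))" if "x \<in> {-1..1}" for x
  proof -
    note L = gegenbauer_lowering[OF has_field_derivative_deriv_gegenbauer, of l x n]
    have "2 * l * (gegenbauer_weight l x * ((1 - x\<^sup>2) * (deriv ?C x * ?G x + deriv ?G x * ?C x)
        - (2 * l + 1) * x * (?C x * ?G x)))
      = gegenbauer_weight l x * ?G x * (2 * l * ((1 - x\<^sup>2) * deriv ?C x - (2 * l + 1) * x * ?C x))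
        + 2 * l * ((1 - x\<^sup>2) * gegenbauer_weight l x * (?C x * deriv ?G x))"
      by (simp add: algebra_simps)
    then show ?thesis unfolding L gegenbauer_weight_Suc[OF that] by (simp add: algebra_simps)
  qed
  show ?thesis
    using has_integral_cong[THEN iffD1, OF 3 has_integral_add[OF 1 2]] by simp
qed

lemma gegenbauer_inner_ladder:
  assumes l: "l > -1/2"
  shows "real (Suc n) * (real (Suc n) + 2 * l) * gegenbauer_inner (Suc n) l (Suc k) \<mu>
           = 4 * l * \<mu> * gegenbauer_inner n (l + 1) k (\<mu> + 1)"
proof -
  have "deriv (gegenbauer (Suc k) \<mu>) x = 2 * \<mu> * gegenbauer k (\<mu> + 1) x" for x
    by (intro DERIV_imp_deriv has_field_derivative_gegenbauer)
  with has_integral_gegenbauer_ladder[OF l, of n "Suc k" \<mu>]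
  have "((\<lambda>x. 2 * l * (gegenbauer_weight (l + 1) x * (gegenbauer n (l + 1) x * (2 * \<mu> * gegenbauer k (\<mu> + 1) x))))
           has_integral real (Suc n) * (real (Suc n) + 2 * l) * gegenbauer_inner (Suc n) l (Suc k) \<mu>) {-1..1}"
    by simp
  moreover have "((\<lambda>x. 4 * l * \<mu> * (gegenbauer_weight (l + 1) x * (gegenbauer n (l + 1) x * gegenbauer k (\<mu> + 1) x)))
           has_integral 4 * l * \<mu> * gegenbauer_inner n (l + 1) k (\<mu> + 1)) {-1..1}"
    using l by (intro has_integral_mult_right has_integral_gegenbauer_inner) auto
  ultimately show ?thesis
    by (auto simp: ac_simps dest: has_integral_unique)
qed

lemma gegenbauer_inner_Suc_0:
  assumes l: "l > -1/2"
  shows "gegenbauer_inner (Suc n) l 0 \<mu> = 0"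
proof -
  have "deriv (gegenbauer 0 \<mu>) x = 0" for x
    by (intro DERIV_imp_deriv has_field_derivative_gegenbauer_0)
  with has_integral_gegenbauer_ladder[OF l, of n 0 \<mu>]
  have "real (Suc n) * (real (Suc n) + 2 * l) * gegenbauer_inner (Suc n) l 0 \<mu> = 0"
    by (simp add: has_integral_0_eq del: of_nat_Suc)
  moreover have "real (Suc n) + 2 * l > 0" using l by simp
  ultimately show ?thesis by simp
qed

text \<open>Put y = C_(k+2)^(\<mu>) and integrate the derivative of (1-x^2)^(l+1/2) y'. The
  differential equation has parameter \<mu> while the weight has l; the mismatch 2(\<mu>-l) x y' is
  resolved by \<open>gegenbauer_x_mult\<close>, which also turns \<mu> into l in the coefficient of
  y.\<close>

lemma gegenbauer_inner_0_rec:
  assumes l: "l > -1/2"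
  shows "real (k + 2) * (real (k + 2) + 2 * l) * gegenbauer_inner 0 l (k + 2) \<mu>
          = 4 * \<mu> * (\<mu> - l) * gegenbauer_inner 0 l k (\<mu> + 1)"
proof -
  let ?p = "\<lambda>x. 2 * \<mu> * gegenbauer (Suc k) (\<mu> + 1) x"
  have "(?p has_field_derivative 2 * \<mu> * (2 * (\<mu> + 1) * gegenbauer k (\<mu> + 1 + 1) x)) (at x)" for x
    by (intro DERIV_cmult has_field_derivative_gegenbauer)
  note 1 = has_integral_gegenbauer_weight_by_parts[OF l this]
  have "((\<lambda>x. - real (k + 2) * (real (k + 2) + 2 * l) * (gegenbauer_weight l x * (gegenbauer 0 l x * gegenbauer (k + 2) \<mu> x))
         + 4 * \<mu> * (\<mu> - l) * (gegenbauer_weight l x * (gegenbauer 0 l x * gegenbauer k (\<mu> + 1) x)))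
      has_integral - real (k + 2) * (real (k + 2) + 2 * l) * gegenbauer_inner 0 l (k + 2) \<mu>
          + 4 * \<mu> * (\<mu> - l) * gegenbauer_inner 0 l k (\<mu> + 1)) {-1..1}"
    by (intro has_integral_add has_integral_mult_right has_integral_gegenbauer_inner l)
  moreover have "- real (k + 2) * (real (k + 2) + 2 * l) * (gegenbauer_weight l x * (gegenbauer 0 l x * gegenbauer (k + 2) \<mu> x))
         + 4 * \<mu> * (\<mu> - l) * (gegenbauer_weight l x * (gegenbauer 0 l x * gegenbauer k (\<mu> + 1) x))
     = gegenbauer_weight l x * ((1 - x\<^sup>2) * (2 * \<mu> * (2 * (\<mu> + 1) * gegenbauer k (\<mu> + 1 + 1) x)) - (2 * l + 1) * x * ?p x)" for x
  proof -
    let ?C = "gegenbauer (k + 2) \<mu> x" and ?E = "gegenbauer k (\<mu> + 1) x"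
    have p: "x * ?p x = real (k + 2) * ?C + 2 * \<mu> * ?E"
      using gegenbauer_x_mult[of \<mu> x k] by (simp add: algebra_simps)
    have "(1 - x\<^sup>2) * (2 * \<mu> * (2 * (\<mu> + 1) * gegenbauer k (\<mu> + 1 + 1) x))
        = (2 * \<mu> + 1) * (x * ?p x) - real (k + 2) * (real (k + 2) + 2 * \<mu>) * ?C"
      using gegenbauer_ode[of \<mu> x k] by (simp add: algebra_simps)
    then have "(1 - x\<^sup>2) * (2 * \<mu> * (2 * (\<mu> + 1) * gegenbauer k (\<mu> + 1 + 1) x)) - (2 * l + 1) * x * ?p x
        = 2 * (\<mu> - l) * (x * ?p x) - real (k + 2) * (real (k + 2) + 2 * \<mu>) * ?C"
      by (simp add: algebra_simps)
    also have "\<dots> = - real (k + 2) * (real (k + 2) + 2 * l) * ?C + 4 * \<mu> * (\<mu> - l) * ?E"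
      unfolding p by (simp add: algebra_simps)
    finally have "gegenbauer_weight l x * ((1 - x\<^sup>2) * (2 * \<mu> * (2 * (\<mu> + 1) * gegenbauer k (\<mu> + 1 + 1) x)) - (2 * l + 1) * x * ?p x)
       = gegenbauer_weight l x * (- real (k + 2) * (real (k + 2) + 2 * l) * ?C + 4 * \<mu> * (\<mu> - l) * ?E)"
      by (rule arg_cong)
    then show ?thesis by (simp only: gegenbauer_0 distrib_left mult_1 ac_simps)
  qed
  ultimately have "0 = - real (k + 2) * (real (k + 2) + 2 * l) * gegenbauer_inner 0 l (k + 2) \<mu>
          + 4 * \<mu> * (\<mu> - l) * gegenbauer_inner 0 l k (\<mu> + 1)"
    using has_integral_unique[OF 1] by (simp only:)
  then show ?thesis by (simp only: mult_minus_left)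
qed

text \<open>The recurrence descends to degree 1, where the integrand is a multiple of x times the
  weight, an exact derivative without boundary terms.\<close>

lemma gegenbauer_inner_0_odd:
  assumes l: "l > -1/2"
  shows "gegenbauer_inner 0 l (Suc (2 * m)) \<mu> = 0"
proof (induction m arbitrary: \<mu>)
  case 0
  have "((\<lambda>x. gegenbauer_weight l x * ((1 - x\<^sup>2) * 0 - (2 * l + 1) * x * 1)) has_integral 0) {-1..1}"
    by (rule has_integral_gegenbauer_weight_by_parts[OF l]) auto
  \<comment> \<open>The constant turns -(2l+1) x into 2 \<mu> x, the polynomial of degree 1.\<close>
  from has_integral_mult_right[OF this, of "- 2 * \<mu> / (2 * l + 1)"]
  have "((\<lambda>x. - 2 * \<mu> / (2 * l + 1) * (gegenbauer_weight l x * ((1 - x\<^sup>2) * 0 - (2 * l + 1) * x * 1)))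
          has_integral 0) {-1..1}" by simp
  moreover have "- 2 * \<mu> / (2 * l + 1) * (gegenbauer_weight l x * ((1 - x\<^sup>2) * 0 - (2 * l + 1) * x * 1))
      = gegenbauer_weight l x * (gegenbauer 0 l x * gegenbauer (Suc (2 * 0)) \<mu> x)" for x
    using l by (auto simp: divide_simps)
  ultimately have "((\<lambda>x. gegenbauer_weight l x * (gegenbauer 0 l x * gegenbauer (Suc (2 * 0)) \<mu> x)) has_integral 0) {-1..1}"
    by simp
  then show ?case using has_integral_unique[OF has_integral_gegenbauer_inner[OF l]] by blast
next
  case (Suc m)
  have "real (Suc (2 * m) + 2) * (real (Suc (2 * m) + 2) + 2 * l) \<noteq> 0" using l by simp
  then show ?case using gegenbauer_inner_0_rec[OF l, of "Suc (2 * m)" \<mu>] Suc[of "\<mu> + 1"] by simp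
qed

text \<open>Unrolling the recurrence m times ends at the total mass of the weight; each step
  multiplies numerator and denominator by one factor of the Pochhammer symbols.\<close>

lemma gegenbauer_inner_0_even:
  assumes l: "l > -1/2"
  shows "gegenbauer_inner 0 l (2 * m) \<mu> =
    pochhammer \<mu> m * pochhammer (\<mu> - l) m / (fact m * pochhammer (l + 1) m) * Beta (l + 1/2) (1/2)"
proof (induction m arbitrary: \<mu>)
  case 0
  have "((\<lambda>x. gegenbauer_weight l x * (gegenbauer 0 l x * gegenbauer 0 \<mu> x)) has_integral Beta (l + 1/2) (1/2)) {-1..1}"
    using has_integral_gegenbauer_weight[OF l] by simp
  then show ?case using has_integral_unique[OF has_integral_gegenbauer_inner[OF l]] by fastforce
next
  case (Suc m)
  have pos: "pochhammer (l + 1) m > 0" "l + 1 + real m > 0" using l by (auto intro: pochhammer_pos)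
  \<comment> \<open>For k = 2m the coefficient (k+2)(k+2+2l) equals 4(m+1)(m+1+l).\<close>
  have "4 * ((real m + 1) * (l + 1 + real m) * gegenbauer_inner 0 l (2 * Suc m) \<mu>)
      = 4 * (\<mu> * (\<mu> - l) * gegenbauer_inner 0 l (2 * m) (\<mu> + 1))"
    using gegenbauer_inner_0_rec[OF l, of "2 * m" \<mu>] by (simp add: algebra_simps)
  then have "(real m + 1) * (l + 1 + real m) * gegenbauer_inner 0 l (2 * Suc m) \<mu>
      = \<mu> * (\<mu> - l) * gegenbauer_inner 0 l (2 * m) (\<mu> + 1)"
    by (rule mult_left_cancel[THEN iffD1, rotated]) simp
  then have "gegenbauer_inner 0 l (2 * Suc m) \<mu> = \<mu> * (\<mu> - l) * gegenbauer_inner 0 l (2 * m) (\<mu> + 1) / ((real m + 1) * (l + 1 + real m))"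
    using pos by (subst nonzero_eq_divide_eq) (simp_all add: ac_simps)
  moreover have "\<mu> + 1 - l = \<mu> - l + 1" by simp
  then have "gegenbauer_inner 0 l (2 * m) (\<mu> + 1) = pochhammer (\<mu> + 1) m * pochhammer (\<mu> - l + 1) m
      / (fact m * pochhammer (l + 1) m) * Beta (l + 1/2) (1/2)"
    using Suc[of "\<mu> + 1"] by (simp only:)
  ultimately show ?case
    unfolding pochhammer_rec[of \<mu> m] pochhammer_rec[of "\<mu> - l" m] pochhammer_Suc[of "l + 1" m]
    by (simp only: fact_Suc of_nat_Suc) (simp add: mult_ac add_ac)
qed

text \<open>The ladder lowers both degrees together, so the smaller one reaches 0 first, where the
  moment vanishes.\<close>

lemma gegenbauer_inner_less:
  assumes "l > -1/2" "k < n"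
  shows "gegenbauer_inner n l k \<mu> = 0"
  using assms
proof (induction k arbitrary: n l \<mu>)
  case 0
  then show ?case by (cases n) (auto simp: gegenbauer_inner_Suc_0)
next
  case (Suc k)
  then obtain m where n: "n = Suc m" "k < m" by (cases n) auto
  have "real (Suc m) + 2 * l > 0" using Suc.prems by simp
  then have "real (Suc m) * (real (Suc m) + 2 * l) \<noteq> 0" by simp
  then show ?case
    using gegenbauer_inner_ladder[OF Suc.prems(1), of m k \<mu>] Suc.IH[of "l + 1" m "\<mu> + 1"] Suc.prems n by simp
qed

text \<open>After i ladder steps the next one contributes 4 (l+i)(\<mu>+i) / ((n-i)(n+2l+i)); the
  product over i < n gives the Pochhammer symbols and the factorial.\<close>

lemma gegenbauer_inner_add:
  assumes "l > -1/2"
  shows "gegenbauer_inner n l (n + j) \<mu> =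
    4 ^ n * pochhammer l n * pochhammer \<mu> n / (fact n * pochhammer (real n + 2 * l) n) * gegenbauer_inner 0 (l + real n) j (\<mu> + real n)"
  using assms
proof (induction n arbitrary: l \<mu>)
  case (Suc n)
  let ?K = "gegenbauer_inner 0 (l + real (Suc n)) j (\<mu> + real (Suc n))"
  have pos: "real n + 1 + 2 * l > 0" "pochhammer (real n + 2 + 2 * l) n > 0"
    using Suc.prems by (auto intro!: pochhammer_pos)
  have "gegenbauer_inner (Suc n) l (Suc n + j) \<mu>
      = 4 * l * \<mu> * gegenbauer_inner n (l + 1) (n + j) (\<mu> + 1) / ((real n + 1) * (real n + 1 + 2 * l))"
    using gegenbauer_inner_ladder[OF Suc.prems, of n "n + j" \<mu>] pos
    by (subst nonzero_eq_divide_eq) (simp_all add: ac_simps)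
  moreover have "gegenbauer_inner n (l + 1) (n + j) (\<mu> + 1)
     = 4 ^ n * pochhammer (l + 1) n * pochhammer (\<mu> + 1) n / (fact n * pochhammer (real n + 2 + 2 * l) n) * ?K"
    using Suc.IH[of "l + 1" "\<mu> + 1"] Suc.prems by (simp add: add_ac distrib_left)
  moreover have "pochhammer (real (Suc n) + 2 * l) (Suc n) = (real n + 1 + 2 * l) * pochhammer (real n + 2 + 2 * l) n"
    by (simp add: pochhammer_rec add_ac)
  ultimately show ?case using pos
    by (simp only: pochhammer_rec[of l] pochhammer_rec[of \<mu>] fact_Suc power_Suc) (simp add: mult_ac add_ac)
qed simp

text \<open>At \<mu> = 1 the lifted parameters are 1 + n and l + n, with difference 1 - l, so the
  even moment formula yields exactly the hypergeometric coefficient. Gamma identities reduce the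
  prefactor to h times c.\<close>

lemma gegenbauer_inner_Chebyshev:
  assumes l: "l > -1/2" and l0: "l \<noteq> 0"
  shows "gegenbauer_inner n l (n + 2 * m) 1 / gegenbauer_h n l
     = c_const n l * (pochhammer (real n + 1) m * pochhammer (1 - l) m / (pochhammer (real n + l + 1) m * fact m))"
proof -
  define q where "q = pochhammer (real n + 1) m * pochhammer (1 - l) m / (pochhammer (real n + l + 1) m * fact m)"
  define a g G D E P where "a = Gamma (l + real n + 1/2)" and "g = Gamma (l + real n)" and "G = Gamma l"
    and "D = Gamma (2 * l + real n)" and "E = Gamma (2 * (l + real n))" and "P = 2 powr (- 2 * (l + real n))"
  \<comment> \<open>The Gamma arguments below may be negative when n = 0, but they are nonzero and
    exceed -1, so no pole is met.\<close>
  have nonint: "y \<notin> \<int>\<^sub>\<le>\<^sub>0" if "y > -1" "y \<noteq> 0" for y :: real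
    using that by (auto elim!: nonpos_Ints_cases)
  have ln: "l + real n \<noteq> 0" "l + real n > - 1/2" using l l0 by (cases n; simp)+
  have ln2: "2 * l + real n \<noteq> 0" "2 * l + real n > - 1" using l l0 by (cases n; simp)+
  have nz: "g \<noteq> 0" "G \<noteq> 0" "D \<noteq> 0" "E \<noteq> 0" "P > 0"
    using nonint[of "l + real n"] nonint[of l] nonint[of "2 * l + real n"] nonint[of "2 * (l + real n)"] ln ln2 l l0
    by (auto simp: g_def G_def D_def E_def P_def Gamma_eq_zero_iff)
  have Gp: "Gamma (l + real n + 1) = (l + real n) * g"
    unfolding g_def using ln by (intro Gamma_plus1 nonint) auto
  have "Gamma (2 * (l + real n) + 1) = 2 * (l + real n) * E"
    unfolding E_def using ln by (intro Gamma_plus1 nonint) auto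
  \<comment> \<open>Duplication is applied at l + n + 1/2 > 0, since l + n itself can be negative;
    the extra factor l + n then cancels.\<close>
  moreover have "a * Gamma (l + real n + 1) = P * sqrt pi * Gamma (2 * (l + real n) + 1)"
    using Gamma_legendre_duplication_real[of "l + real n + 1/2"] ln unfolding a_def P_def
    by (simp add: algebra_simps)
  ultimately have "(l + real n) * (a * g) = (l + real n) * (2 * P * sqrt pi * E)"
    unfolding Gp by (simp only: ac_simps)
  then have "a * g = 2 * P * sqrt pi * E" using ln by simp
  then have ag: "a = 2 * P * sqrt pi * E / g" using nz by (simp add: nonzero_eq_divide_eq)
  have p1: "pochhammer l n = g / G"
    unfolding g_def G_def using l l0 by (intro pochhammer_Gamma nonint) auto
  have "pochhammer (2 * l + real n) n = Gamma (2 * l + real n + real n) / D"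
    unfolding D_def using ln2 by (intro pochhammer_Gamma nonint) auto
  then have p2: "pochhammer (real n + 2 * l) n = E / D"
    unfolding E_def by (simp add: algebra_simps)
  have B: "Beta (l + real n + 1/2) (1/2) = a * sqrt pi / ((l + real n) * g)"
    unfolding Beta_def a_def Gamma_one_half_real using Gp by (simp add: add_ac)
  have P: "2 powr (1 - 2 * l) = 2 * 4 ^ n * P"
  proof -
    have "1 - 2 * l = 1 + real (2 * n) + (- 2 * (l + real n))" by simp
    then show ?thesis unfolding P_def
      by (simp only: powr_add powr_realpow) (simp add: power_mult)
  qed
  have "gegenbauer_inner n l (n + 2 * m) 1
      = 4 ^ n * pochhammer l n / pochhammer (real n + 2 * l) n * (Beta (l + real n + 1/2) (1/2) * q)"
    unfolding gegenbauer_inner_add[OF l] q_def using ln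
    by (subst gegenbauer_inner_0_even) (simp_all add: pochhammer_fact[symmetric] add_ac mult_ac)
  also have "\<dots> = 4 ^ n * (g / G) / (E / D) * (2 * P * sqrt pi * E / g * sqrt pi / ((l + real n) * g) * q)"
    unfolding p1 p2 B ag ..
  also have "\<dots> = 2 * 4 ^ n * P * (sqrt pi * sqrt pi) * D / (G * (l + real n) * g) * q"
  proof -
    have "4 ^ n * (g / G) / (E / D) * (2 * P * r * E / g * r / (s * g) * q)
        = 2 * 4 ^ n * P * (r * r) * D / (G * s * g) * q" if "s \<noteq> 0" for r s
      using nz that by (simp add: field_simps)
    then show ?thesis using ln by blast
  qed
  finally have I: "gegenbauer_inner n l (n + 2 * m) 1 = 2 * 4 ^ n * P * pi * D / (G * (l + real n) * g) * q"
    by simp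
  have h: "gegenbauer_h n l = 2 * 4 ^ n * P * pi / G\<^sup>2 * D / (Gamma (real n + 1) * (l + real n))"
    unfolding gegenbauer_h_def P G_def D_def by (simp add: add_ac)
  have F: "Gamma (real n + 1) \<noteq> 0" by (simp add: Gamma_eq_zero_iff nonint)
  have c: "c_const n l = G * Gamma (real n + 1) / g"
    unfolding c_const_def G_def g_def by (simp add: add_ac)
  have "2 * 4 ^ n * P * pi * D / (G * s * g) * q / (2 * 4 ^ n * P * pi / G\<^sup>2 * D / (Gamma (real n + 1) * s))
      = G * Gamma (real n + 1) / g * q" if "s \<noteq> 0" for s
    using nz that F by (simp add: field_simps power2_eq_square)
  from this[OF ln(1)] show ?thesis unfolding I h c q_def .
qed

lemma gegenbauer_h_c_const_nonzero:
  assumes l: "l > -1/2" "l \<noteq> 0"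
  shows "gegenbauer_h n l \<noteq> 0" "c_const n l \<noteq> 0"
proof -
  have nonint: "Gamma y \<noteq> 0" if "y > -1" "y \<noteq> 0" for y :: real
    using that by (auto elim!: nonpos_Ints_cases simp: Gamma_eq_zero_iff)
  have "real n + l \<noteq> 0" "real n + l > - 1/2" "real n + 2 * l \<noteq> 0" "real n + 2 * l > - 1"
    using l by (cases n; simp)+
  then show "gegenbauer_h n l \<noteq> 0" "c_const n l \<noteq> 0"
    using l by (simp_all add: gegenbauer_h_def c_const_def nonint)
qed

section \<open>The Joukowski map and the Bernstein ellipse\<close>

definition joukowski :: "complex \<Rightarrow> complex" where
  "joukowski w = (w + inverse w) / 2"

lemma has_field_derivative_joukowski:
  "w \<noteq> 0 \<Longrightarrow> (joukowski has_field_derivative (1 - inverse (w\<^sup>2)) / 2) (at w)"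
  unfolding joukowski_def[abs_def]
  by (auto intro!: derivative_eq_intros simp: power2_eq_square)

lemma deriv_joukowski: "w \<noteq> 0 \<Longrightarrow> deriv joukowski w = (1 - inverse (w\<^sup>2)) / 2"
  by (rule DERIV_imp_deriv[OF has_field_derivative_joukowski])

lemma analytic_on_joukowski: "joukowski analytic_on - {0}"
  unfolding joukowski_def[abs_def] by (intro analytic_intros) auto

text \<open>The two candidates z + sqrt(z^2-1) and z - sqrt(z^2-1) are w and 1/w in some order, and
  only w lies outside the unit disc; hence the branch of \<open>csqrt\<close> does not
  matter.\<close>

lemma joukowski_inv_joukowski:
  assumes "norm w > 1"
  shows "joukowski_inv (joukowski w) = w"
proof -
  have w0: "w \<noteq> 0" using assms by auto
  define a where "a = (w - inverse w) / 2"
  have "(joukowski w)\<^sup>2 - 1 = a\<^sup>2"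
    using w0 by (simp add: joukowski_def a_def field_simps power2_eq_square)
  then have c: "csqrt ((joukowski w)\<^sup>2 - 1) = a \<or> csqrt ((joukowski w)\<^sup>2 - 1) = - a"
    by (metis power2_csqrt power2_eq_iff)
  have p: "joukowski w + a = w" and m: "joukowski w - a = inverse w"
    by (simp_all add: joukowski_def a_def field_simps)
  have "\<not> norm (inverse w) > 1"
    using assms by (simp add: norm_inverse inverse_less_1_iff not_less inverse_le_1_iff)
  with c show ?thesis
    using assms p m by (auto simp: joukowski_inv_def)
qed

lemma bernstein_ellipse_eq: "bernstein_ellipse \<rho> = joukowski \<circ> circlepath 0 \<rho>"
proof
  fix t
  have "exp (2 * complex_of_real pi * \<i> * complex_of_real t) = cis (2 * pi * t)"
    by (simp add: cis_conv_exp mult_ac)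
  moreover have "inverse (cis (2 * pi * t)) = cis (- (2 * pi * t))" by simp
  ultimately show "bernstein_ellipse \<rho> t = (joukowski \<circ> circlepath 0 \<rho>) t"
    by (simp add: bernstein_ellipse_def joukowski_def circlepath inverse_eq_divide[symmetric] del: cis_inverse)
qed

lemma contour_integral_bernstein_ellipse:
  assumes "\<rho> > 0"
  shows "contour_integral (bernstein_ellipse \<rho>) g =
    contour_integral (circlepath 0 \<rho>) (\<lambda>w. deriv joukowski w * g (joukowski w))"
  unfolding bernstein_ellipse_eq using assms
  by (intro contour_integral_comp_analyticW[OF analytic_on_joukowski]) auto

text \<open>For x = cos t the numbers exp(it) and exp(-it) are the roots of w^2 - 2xw + 1.\<close>

lemma joukowski_minus_real:
  assumes "\<bar>x\<bar> \<le> 1" "w \<noteq> 0"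
  defines "v \<equiv> cis (arccos x)"
  shows "joukowski w - complex_of_real x = (w - v) * (w - inverse v) / (2 * w)"
proof -
  have x: "cos (arccos x) = x" using assms by simp
  have e: "v + inverse v = 2 * complex_of_real x"
    unfolding v_def by (simp add: complex_eq_iff x cos_arccos_abs)
  have v: "v \<noteq> 0" by (simp add: v_def)
  have "(w - v) * (w - inverse v) = w * w - w * (v + inverse v) + 1"
    using v by (simp add: algebra_simps)
  then show ?thesis
    unfolding e using assms(2) by (simp add: joukowski_def field_simps)
qed

lemma joukowski_neq_real:
  assumes "\<bar>x\<bar> \<le> 1" "norm w > 1"
  shows "joukowski w \<noteq> complex_of_real x"
proof -
  have "w \<noteq> 0" using assms by auto
  moreover have "norm (cis (arccos x)) = 1" "norm (inverse (cis (arccos x))) = 1" by simp_all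
  then have "w \<noteq> cis (arccos x)" "w \<noteq> inverse (cis (arccos x))" using assms by auto
  ultimately show ?thesis using joukowski_minus_real[of x w] assms by auto
qed

section \<open>Generating function and termwise integration\<close>

lemma summable_Suc_mult_power:
  assumes "norm (t::real) < 1"
  shows "summable (\<lambda>k. (real k + 1) * t ^ k)"
  using sums_summable[OF geometric_deriv_sums[OF assms]] by (simp add: add_ac)

text \<open>Multiplying a partial sum by 1 - 2xt + t^2 telescopes by the three-term recurrence; the
  two leftover terms tend to 0 because the bound k + 1 makes the series summable.\<close>

lemma sums_gegenbauer_one:
  fixes t :: complex
  assumes x: "\<bar>x\<bar> \<le> 1" and t: "norm t < 1" and nz: "1 - 2 * of_real x * t + t\<^sup>2 \<noteq> 0"
  shows "(\<lambda>k. of_real (gegenbauer k 1 x) * t ^ k) sums (1 / (1 - 2 * of_real x * t + t\<^sup>2))"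
proof -
  let ?u = "\<lambda>k. complex_of_real (gegenbauer k 1 x)"
  let ?q = "1 - 2 * of_real x * t + t\<^sup>2"
  have part: "?q * (\<Sum>k<Suc n. ?u k * t ^ k) = 1 - ?u (Suc n) * t ^ Suc n + t\<^sup>2 * (?u n * t ^ n)" for n
  proof (induction n)
    case (Suc n)
    have "complex_of_real (gegenbauer (Suc (Suc n)) 1 x) = 2 * of_real x * ?u (Suc n) - ?u n"
      using gegenbauer_one_rec[of n x] by simp
    then have rec: "?u (Suc (Suc n)) = 2 * of_real x * ?u (Suc n) - ?u n" .
    have "?q * (\<Sum>k<Suc (Suc n). ?u k * t ^ k)
        = ?q * (\<Sum>k<Suc n. ?u k * t ^ k) + ?q * (?u (Suc n) * t ^ Suc n)"
      by (subst sum.lessThan_Suc) (rule distrib_left)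
    then show ?case unfolding Suc rec by (simp add: algebra_simps power2_eq_square)
  qed (simp add: algebra_simps)
  have "summable (\<lambda>k. ?u k * t ^ k)"
  proof (rule summable_comparison_test')
    show "summable (\<lambda>k. (real k + 1) * norm t ^ k)" using t by (intro summable_Suc_mult_power) auto
    show "norm (?u k * t ^ k) \<le> (real k + 1) * norm t ^ k" if "k \<ge> 0" for k
      using gegenbauer_one_bound[OF x, of k] by (simp add: norm_mult norm_power mult_right_mono)
  qed
  then have lim: "(\<lambda>k. ?u k * t ^ k) \<longlonglongrightarrow> 0" by (rule summable_LIMSEQ_zero)
  have "(\<lambda>n. (1 - ?u (Suc n) * t ^ Suc n + t\<^sup>2 * (?u n * t ^ n)) / ?q) \<longlonglongrightarrow> (1 - 0 + t\<^sup>2 * 0) / ?q"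
    by (intro tendsto_intros lim LIMSEQ_Suc[OF lim] nz)
  then have "(\<lambda>n. \<Sum>k<Suc n. ?u k * t ^ k) \<longlonglongrightarrow> 1 / ?q"
    unfolding part[symmetric] using nz by simp
  then show ?thesis unfolding sums_def by (rule LIMSEQ_imp_Suc)
qed

lemma sums_inverse_joukowski_minus:
  assumes x: "\<bar>x\<bar> \<le> 1" and w: "norm w > 1"
  shows "(\<lambda>k. of_real (gegenbauer k 1 x) * inverse w ^ Suc k) sums (1 / (2 * (joukowski w - of_real x)))"
proof -
  have w0: "w \<noteq> 0" using w by auto
  have ne: "joukowski w - of_real x \<noteq> 0" using joukowski_neq_real[OF x w] by simp
  \<comment> \<open>The generating function is used at t = 1/w, where its denominator becomes 2
    (J(w) - x) / w.\<close>
  have q: "1 - 2 * of_real x * inverse w + (inverse w)\<^sup>2 = 2 * (joukowski w - of_real x) * inverse w"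
    using w0 by (simp add: joukowski_def algebra_simps power2_eq_square)
  have "norm (inverse w) < 1" using w by (simp add: norm_inverse inverse_less_1_iff)
  from sums_mult[OF sums_gegenbauer_one[OF x this], of "inverse w"] show ?thesis
    unfolding q using ne w0 by (simp add: mult_ac)
qed

lemma contour_integral_circlepath_sums:
  fixes g :: "nat \<Rightarrow> complex \<Rightarrow> complex"
  assumes "r > 0" and cont: "\<And>k. continuous_on (sphere z r) (g k)"
    and le: "\<And>k w. w \<in> sphere z r \<Longrightarrow> norm (g k w) \<le> M k" and M: "summable M"
  shows "(\<lambda>k. contour_integral (circlepath z r) (g k)) sums
           contour_integral (circlepath z r) (\<lambda>w. \<Sum>k. g k w)"
proof -
  have int: "g k contour_integrable_on circlepath z r" for k
    using cont assms(1) by (intro contour_integrable_continuous_circlepath) simp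
  have "uniform_limit (sphere z r) (\<lambda>n w. \<Sum>k<n. g k w) (\<lambda>w. \<Sum>k. g k w) sequentially"
    by (rule Weierstrass_m_test[OF le M])
  then have "((\<lambda>n. contour_integral (circlepath z r) (\<lambda>w. \<Sum>k<n. g k w)) \<longlongrightarrow>
          contour_integral (circlepath z r) (\<lambda>w. \<Sum>k. g k w)) sequentially"
    using assms(1)
    by (intro contour_integral_uniform_limit_circlepath)
       (auto intro!: always_eventually contour_integrable_sum int)
  then show ?thesis
    unfolding sums_def by (subst (asm) contour_integral_sum) (auto intro: int)
qed

text \<open>Dominated convergence with the weight times the sum of the bounds as integrable
  majorant, which accommodates a weight unbounded at the endpoints.\<close>

lemma integral_gegenbauer_weight_sums:
  fixes g :: "nat \<Rightarrow> real \<Rightarrow> complex"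
  assumes l: "l > -1/2" and cont: "\<And>k. continuous_on {-1..1} (g k)"
    and le: "\<And>k x. x \<in> {-1..1} \<Longrightarrow> norm (g k x) \<le> M k" and M: "summable M"
  shows "(\<lambda>k. integral {-1..1} (\<lambda>x. gegenbauer_weight l x *\<^sub>R g k x)) sums
           integral {-1..1} (\<lambda>x. gegenbauer_weight l x *\<^sub>R (\<Sum>k. g k x))"
proof -
  have int: "(\<lambda>x. gegenbauer_weight l x *\<^sub>R g k x) integrable_on {-1..1}" for k
    using absolutely_integrable_gegenbauer_weight[OF l cont] by (simp add: absolutely_integrable_on_def)
  have M0: "M k \<ge> 0" for k by (rule order_trans[OF norm_ge_zero le[of 0 k]]) simp
  have "(\<lambda>n. integral {-1..1} (\<lambda>x. gegenbauer_weight l x *\<^sub>R (\<Sum>k<n. g k x)))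
         \<longlonglongrightarrow> integral {-1..1} (\<lambda>x. gegenbauer_weight l x *\<^sub>R (\<Sum>k. g k x))"
  proof (rule dominated_convergence(2)[where h = "\<lambda>x. gegenbauer_weight l x * suminf M"])
    show "(\<lambda>x. gegenbauer_weight l x *\<^sub>R (\<Sum>k<n. g k x)) integrable_on {-1..1}" for n
      unfolding scaleR_sum_right by (intro integrable_sum int) auto
    show "(\<lambda>x. gegenbauer_weight l x * suminf M) integrable_on {-1..1}"
      by (intro integrable_gegenbauer_weight l continuous_intros)
  next
    fix n and x :: real assume x: "x \<in> {-1..1}"
    have "norm (\<Sum>k<n. g k x) \<le> (\<Sum>k<n. M k)" using le[OF x] by (rule sum_norm_le)
    also have "\<dots> \<le> suminf M" by (intro sum_le_suminf M) (auto simp: M0)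
    finally show "norm (gegenbauer_weight l x *\<^sub>R (\<Sum>k<n. g k x)) \<le> gegenbauer_weight l x * suminf M"
      by (simp add: mult_left_mono)
  next
    fix x :: real assume x: "x \<in> {-1..1}"
    have "summable (\<lambda>k. g k x)" by (rule summable_comparison_test'[OF M, of 0]) (rule le[OF x])
    then show "(\<lambda>n. gegenbauer_weight l x *\<^sub>R (\<Sum>k<n. g k x)) \<longlonglongrightarrow> gegenbauer_weight l x *\<^sub>R (\<Sum>k. g k x)"
      by (intro tendsto_intros summable_LIMSEQ)
  qed
  then show ?thesis
    unfolding sums_def scaleR_sum_right by (subst (asm) integral_sum) (auto intro: int)
qed

section \<open>The ellipse as a contour and the region it bounds\<close>

lemma valid_path_bernstein_ellipse: "\<rho> > 0 \<Longrightarrow> valid_path (bernstein_ellipse \<rho>)"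
  unfolding bernstein_ellipse_eq
  by (intro valid_path_compose_analytic[OF _ analytic_on_joukowski]) auto

lemma path_image_bernstein_ellipse:
  "\<rho> > 0 \<Longrightarrow> path_image (bernstein_ellipse \<rho>) = joukowski ` sphere 0 \<rho>"
  by (simp add: bernstein_ellipse_eq path_image_compose)

text \<open>Pulled back to the circle, J'/(J - x) equals 1/(w-v) + 1/(w-1/v) - 1/w with v on the
  unit circle. All three poles lie inside, giving 1 + 1 - 1 = 1.\<close>

lemma winding_number_bernstein_ellipse:
  assumes \<rho>: "\<rho> > 1" and x: "\<bar>x\<bar> \<le> 1"
  shows "winding_number (bernstein_ellipse \<rho>) (of_real x) = 1"
proof -
  define v where "v = cis (arccos x)"
  let ?C = "circlepath 0 \<rho>"
  have v: "norm v = 1" "norm (inverse v) = 1" "v \<noteq> 0" by (auto simp: v_def)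
  have ni: "of_real x \<notin> path_image (bernstein_ellipse \<rho>)"
    using joukowski_neq_real[OF x] \<rho> by (force simp: path_image_bernstein_ellipse)
  have int: "((\<lambda>w. 1 / (w - a)) has_contour_integral 2 * of_real pi * \<i>) ?C" if "norm a < \<rho>" for a
  proof -
    have "a \<notin> path_image ?C" using that \<rho> by auto
    then show ?thesis
      using has_contour_integral_winding_number[of ?C a] winding_number_circlepath[of a 0 \<rho>] that by simp
  qed
  have "((\<lambda>w. 1 / (w - v) + 1 / (w - inverse v) - 1 / (w - 0)) has_contour_integral
     2 * of_real pi * \<i> + 2 * of_real pi * \<i> - 2 * of_real pi * \<i>) ?C"
    using v \<rho> by (intro has_contour_integral_add has_contour_integral_diff int) auto
  then have I: "contour_integral ?C (\<lambda>w. 1 / (w - v) + 1 / (w - inverse v) - 1 / (w - 0)) = 2 * of_real pi * \<i>"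
    by (simp add: contour_integral_unique)
  have "winding_number (bernstein_ellipse \<rho>) (of_real x) =
     1 / (2 * pi * \<i>) * contour_integral (bernstein_ellipse \<rho>) (\<lambda>z. 1 / (z - of_real x))"
    using \<rho> by (intro winding_number_valid_path valid_path_bernstein_ellipse ni) auto
  also have "contour_integral (bernstein_ellipse \<rho>) (\<lambda>z. 1 / (z - of_real x))
     = contour_integral ?C (\<lambda>w. 1 / (w - v) + 1 / (w - inverse v) - 1 / (w - 0))"
  proof -
    have "deriv joukowski w * (1 / (joukowski w - of_real x)) = 1 / (w - v) + 1 / (w - inverse v) - 1 / (w - 0)"
      if "w \<in> path_image ?C" for w
    proof -
      have w: "norm w = \<rho>" "w \<noteq> 0" using that \<rho> by auto
      then have ne: "w - v \<noteq> 0" "w - inverse v \<noteq> 0" using v \<rho> by auto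
      have "1 / (w - v) + 1 / (w - u) - 1 / (w - 0) = (w\<^sup>2 - 1) / (w * (w - v) * (w - u))"
        if "w - u \<noteq> 0" "v * u = 1" for u
      proof -
        have "1 / a + 1 / b - 1 / w = (b * w + a * w - a * b) / (w * a * b)"
          if "a \<noteq> 0" "b \<noteq> 0" for a b using w(2) that by (simp add: field_simps)
        from this[OF ne(1) that(1)]
        have "1 / (w - v) + 1 / (w - u) - 1 / w
            = ((w - u) * w + (w - v) * w - (w - v) * (w - u)) / (w * (w - v) * (w - u))" .
        also have "(w - u) * w + (w - v) * w - (w - v) * (w - u) = w\<^sup>2 - v * u"
          by (simp add: algebra_simps power2_eq_square)
        finally show ?thesis using that by simp
      qed
      from this[of "inverse v"] have "1 / (w - v) + 1 / (w - inverse v) - 1 / (w - 0)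
          = (w\<^sup>2 - 1) / (w * (w - v) * (w - inverse v))" using ne v by simp
      moreover have "deriv joukowski w = (w\<^sup>2 - 1) / (2 * w * w)"
        using w(2) by (simp add: deriv_joukowski field_simps power2_eq_square)
      ultimately show ?thesis
        using joukowski_minus_real[OF x w(2)] w(2) unfolding v_def[symmetric] by simp
    qed
    then show ?thesis using \<rho> by (subst contour_integral_bernstein_ellipse) (auto intro!: contour_integral_eq)
  qed
  finally show ?thesis unfolding I by simp
qed

text \<open>Rescaling the axes is linear, so convexity is inherited from the unit disc.\<close>

lemma bernstein_region_eq_vimage:
  "bernstein_region \<rho> =
     (\<lambda>z. Complex (Re z / ((\<rho> + 1/\<rho>) / 2)) (Im z / ((\<rho> - 1/\<rho>) / 2))) -` cball 0 1"
  unfolding bernstein_region_def vimage_def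
  by (simp add: cmod_def power_divide)

lemma convex_bernstein_region: "convex (bernstein_region \<rho>)"
  unfolding bernstein_region_eq_vimage
  by (intro convex_linear_vimage convex_cball)
     (auto simp: linear_iff complex_eq_iff add_divide_distrib)

lemma joukowski_in_bernstein_region:
  assumes "\<rho> > 1" "norm w = \<rho>"
  shows "joukowski w \<in> bernstein_region \<rho>"
proof -
  define t where "t = Arg w"
  have w: "w = of_real \<rho> * cis t" using assms by (metis t_def rcis_cmod_Arg rcis_def)
  have "\<rho> + 1/\<rho> > 0" "\<rho> - 1/\<rho> > 0"
    using assms less_1_mult[of \<rho> \<rho>] by (auto simp: field_simps add_pos_pos)
  moreover have ReIm: "Re (joukowski w) = (\<rho> + 1/\<rho>) / 2 * cos t" "Im (joukowski w) = (\<rho> - 1/\<rho>) / 2 * sin t"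
    unfolding joukowski_def w by (simp_all add: algebra_simps inverse_eq_divide[symmetric] flip: of_real_inverse)
  ultimately show ?thesis
    unfolding bernstein_region_def mem_Collect_eq ReIm power_mult_distrib by simp
qed

text \<open>The strict inequality cuts out an open subset of the region, and the major semi-axis
  (\<rho> + 1/\<rho>)/2 exceeds 1 because (\<rho>-1)^2 > 0.\<close>

lemma real_in_interior_bernstein_region:
  assumes "\<rho> > 1" "\<bar>x\<bar> \<le> 1"
  shows "complex_of_real x \<in> interior (bernstein_region \<rho>)"
proof (rule interiorI)
  let ?S = "{z. (Re z)\<^sup>2 / ((\<rho> + 1/\<rho>) / 2)\<^sup>2 + (Im z)\<^sup>2 / ((\<rho> - 1/\<rho>) / 2)\<^sup>2 < 1}"
  have "\<rho> - 1/\<rho> > 0" using assms less_1_mult[of \<rho> \<rho>] by (simp add: field_simps)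
  moreover have "\<rho> + 1/\<rho> > 0" using assms by (simp add: add_pos_pos)
  ultimately show "open ?S" by (intro open_Collect_less continuous_intros) auto
  have "(\<rho> - 1)\<^sup>2 > 0" using assms by simp
  then have "(\<rho> + 1/\<rho>) / 2 > 1" using assms by (simp add: field_simps power2_eq_square)
  then have "((\<rho> + 1/\<rho>) / 2)\<^sup>2 > 1" by (simp add: one_less_power)
  moreover have "x\<^sup>2 \<le> 1" using assms by (simp add: abs_square_le_1)
  ultimately show "complex_of_real x \<in> ?S" by (simp add: divide_less_eq)
qed (auto simp: bernstein_region_def)

section \<open>Vanishing and growth of the moments\<close>

lemma gegenbauer_inner_not_shift:
  assumes l: "l > -1/2" and k: "k \<notin> range (\<lambda>m. n + 2 * m)"
  shows "gegenbauer_inner n l k \<mu> = 0"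
proof (cases "k < n")
  case False
  then obtain j where j: "k = n + j" using le_Suc_ex not_less by blast
  with k have "odd j" by (auto elim!: evenE)
  then obtain i where "j = Suc (2 * i)" by (metis oddE Suc_eq_plus1)
  with j l show ?thesis by (simp add: gegenbauer_inner_add gegenbauer_inner_0_odd del: add_Suc_right)
qed (use gegenbauer_inner_less l in blast)

text \<open>Since the hypergeometric coefficients are moments up to a constant factor, this gives
  their linear growth without asymptotics of Pochhammer symbols.\<close>

lemma gegenbauer_inner_Chebyshev_bound:
  assumes l: "l > -1/2"
  obtains B where "\<And>k. \<bar>gegenbauer_inner n l k 1\<bar> \<le> B * (real k + 1)"
proof -
  have "bounded (gegenbauer n l ` {-1..1})"
    by (intro compact_imp_bounded compact_continuous_image continuous_intros) auto
  then obtain b where b: "\<And>x. x \<in> {-1..1} \<Longrightarrow> \<bar>gegenbauer n l x\<bar> \<le> b"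
    unfolding bounded_iff ball_simps real_norm_def by blast
  have "\<bar>gegenbauer_inner n l k 1\<bar> \<le> (Beta (l + 1/2) (1/2) * b) * (real k + 1)" for k
  proof -
    have h: "((\<lambda>x. gegenbauer_weight l x * (b * (real k + 1))) has_integral Beta (l + 1/2) (1/2) * (b * (real k + 1))) {-1..1}"
      by (intro has_integral_mult_left has_integral_gegenbauer_weight l)
    have "norm (gegenbauer_weight l x * (gegenbauer n l x * gegenbauer k 1 x)) \<le> gegenbauer_weight l x * (b * (real k + 1))"
      if "x \<in> {-1..1}" for x
    proof -
      have "\<bar>gegenbauer n l x\<bar> * \<bar>gegenbauer k 1 x\<bar> \<le> b * (real k + 1)"
        using b[OF that] gegenbauer_one_bound[of x k] that by (intro mult_mono) auto
      then show ?thesis by (simp add: abs_mult mult_left_mono)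
    qed
    then have "norm (gegenbauer_inner n l k 1) \<le> integral {-1..1} (\<lambda>x. gegenbauer_weight l x * (b * (real k + 1)))"
      unfolding gegenbauer_inner_def
      by (intro integral_norm_bound_integral has_integral_integrable[OF h]
                has_integral_integrable[OF has_integral_gegenbauer_inner[OF l]]) auto
    then show ?thesis unfolding integral_unique[OF h] by (simp add: mult_ac)
  qed
  then show ?thesis using that by blast
qed

section \<open>The coefficient formula\<close>

theorem theorem3p2:
  fixes lam \<rho> :: real and f :: "complex \<Rightarrow> complex" and n :: nat
  assumes "lam > -1/2" and "lam \<noteq> 0" and "\<rho> > 1"
    and "f analytic_on bernstein_region \<rho>"
  shows "gegenbauer_coeff lam f n =
    complex_of_real (c_const n lam) / (\<i> * complex_of_real pi) *
    contour_integral (bernstein_ellipse \<rho>)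
      (\<lambda>z. f z / (joukowski_inv z) ^ (n + 1) *
           hyp2F1 (of_nat n + 1) (1 - complex_of_real lam) (of_nat n + complex_of_real lam + 1)
                  (1 / (joukowski_inv z)\<^sup>2))"
proof -
  note l = assms(1) and l0 = assms(2) and \<rho> = assms(3) and f = assms(4)
  let ?C = "circlepath 0 \<rho>"
  \<comment> \<open>\<open>F\<close> is f(z) dz pulled back to the circle along z = J(w);
    \<open>A k\<close> will be i pi times the coefficient of C_k^(1) in the expansion of f.\<close>
  define F where "F = (\<lambda>w. deriv joukowski w * f (joukowski w))"
  define A where "A = (\<lambda>k. contour_integral ?C (\<lambda>w. F w * inverse w ^ Suc k))"
  have nz: "w \<noteq> 0" "norm w > 1" "norm w = \<rho>" if "w \<in> sphere 0 \<rho>" for w :: complex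
    using that \<rho> by auto

  have contF: "continuous_on (sphere 0 \<rho>) F"
  proof -
    have cj: "continuous_on (sphere 0 \<rho>) joukowski"
      unfolding joukowski_def[abs_def] by (intro continuous_intros) (use nz in auto)
    have cf: "continuous_on (bernstein_region \<rho>) f"
      using f analytic_imp_holomorphic holomorphic_on_imp_continuous_on by blast
    have "joukowski ` sphere 0 \<rho> \<subseteq> bernstein_region \<rho>"
      using joukowski_in_bernstein_region[OF \<rho>] nz(3) by blast
    then have "continuous_on (sphere 0 \<rho>) (\<lambda>w. f (joukowski w))"
      by (rule continuous_on_compose2[OF cf cj])
    moreover have "continuous_on (sphere 0 \<rho>) (\<lambda>w::complex. (1 - inverse (w\<^sup>2)) / 2)"
      by (intro continuous_intros) (use nz in auto)
    then have "continuous_on (sphere 0 \<rho>) (deriv joukowski)"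
      by (rule continuous_on_eq) (use nz deriv_joukowski in auto)
    ultimately show ?thesis unfolding F_def by (intro continuous_intros)
  qed
  have contFw: "continuous_on (sphere 0 \<rho>) (\<lambda>w. F w * inverse w ^ k)" for k
    by (intro continuous_intros contF) (use nz in auto)
  have "bounded (F ` sphere 0 \<rho>)"
    by (intro compact_imp_bounded compact_continuous_image contF) auto
  then obtain B where B: "\<And>w. w \<in> sphere 0 \<rho> \<Longrightarrow> norm (F w) \<le> B"
    unfolding bounded_iff ball_simps by blast
  have B0: "B \<ge> 0"
    by (rule order_trans[OF norm_ge_zero B[of "of_real \<rho>"]]) (use \<rho> in simp)
  have Fw: "norm (F w * inverse w ^ k) \<le> B * (1/\<rho>) ^ k" if "w \<in> sphere 0 \<rho>" for w k
    using B[OF that] nz[OF that] \<rho>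
    by (simp add: norm_mult norm_power norm_divide inverse_eq_divide mult_right_mono)
  have small: "norm (1/\<rho>) < 1" using \<rho> by simp
  \<comment> \<open>The length 2 pi \<rho> of the circle absorbs one of the k + 1 factors
    1/\<rho>.\<close>
  have bA: "norm (A k) \<le> 2 * pi * B * (1/\<rho>) ^ k" for k
  proof -
    have "((\<lambda>w. F w * inverse w ^ Suc k) has_contour_integral A k) ?C"
      unfolding A_def using contFw[of "Suc k"] \<rho>
      by (intro has_contour_integral_integral contour_integrable_continuous_circlepath) auto
    then have "norm (A k) \<le> B * (1/\<rho>) ^ Suc k * (2 * pi * \<rho>)"
    proof (rule has_contour_integral_bound_circlepath)
      show "norm (F w * inverse w ^ Suc k) \<le> B * (1/\<rho>) ^ Suc k" if "norm (w - 0) = \<rho>" for w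
        using that by (intro Fw) simp
    qed (use B0 \<rho> in auto)
    then show ?thesis using \<rho> by (simp add: mult_ac)
  qed

  \<comment> \<open>The expansion of f on [-1,1] in the polynomials C_k^(1): the generating function
    is inserted in Cauchy's formula and integrated term by term.\<close>
  have f_sums: "(\<lambda>k. gegenbauer k 1 x *\<^sub>R (A k / (\<i> * of_real pi))) sums f (of_real x)"
    if "x \<in> {-1..1}" for x
  proof -
    have x: "\<bar>x\<bar> \<le> 1" using that by auto
    let ?g = "\<lambda>k w. of_real (gegenbauer k 1 x) * (F w * inverse w ^ Suc k)"
    have "(\<lambda>k. contour_integral ?C (?g k)) sums contour_integral ?C (\<lambda>w. \<Sum>k. ?g k w)"
    proof (rule contour_integral_circlepath_sums)
      show "summable (\<lambda>k. B * (1/\<rho>) * ((real k + 1) * (1/\<rho>) ^ k))"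
        by (intro summable_mult summable_Suc_mult_power small)
      show "continuous_on (sphere 0 \<rho>) (?g k)" for k
        by (intro continuous_on_mult_left contFw)
      show "norm (?g k w) \<le> B * (1/\<rho>) * ((real k + 1) * (1/\<rho>) ^ k)" if "w \<in> sphere 0 \<rho>" for k w
      proof -
        have "norm (?g k w) = \<bar>gegenbauer k 1 x\<bar> * norm (F w * inverse w ^ Suc k)"
          by (simp only: norm_mult norm_of_real)
        also have "\<dots> \<le> (real k + 1) * (B * (1/\<rho>) ^ Suc k)"
          by (intro mult_mono Fw gegenbauer_one_bound x that) auto
        finally show ?thesis by (simp add: mult_ac)
      qed
    qed (use \<rho> in auto)
    moreover have "contour_integral ?C (?g k) = of_real (gegenbauer k 1 x) * A k" for k
      unfolding A_def using contFw[of "Suc k"] \<rho>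
      by (intro contour_integral_lmul contour_integrable_continuous_circlepath) simp
    \<comment> \<open>Cauchy's formula on the ellipse gives 2 pi i f(x); the half in the generating
      function leaves i pi f(x).\<close>
    moreover have "contour_integral ?C (\<lambda>w. \<Sum>k. ?g k w) = \<i> * of_real pi * f (of_real x)"
    proof -
      have "(\<Sum>k. ?g k w) = deriv joukowski w * (f (joukowski w) / (joukowski w - of_real x) / 2)"
        if "w \<in> sphere 0 \<rho>" for w
        using sums_unique[OF sums_mult[OF sums_inverse_joukowski_minus[OF x nz(2)[OF that]], of "F w"]]
        by (simp add: F_def mult_ac)
      then have "contour_integral ?C (\<lambda>w. \<Sum>k. ?g k w)
          = contour_integral (bernstein_ellipse \<rho>) (\<lambda>z. f z / (z - of_real x) / 2)"
        using \<rho> by (subst contour_integral_bernstein_ellipse) (auto intro!: contour_integral_eq)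
      also have "\<dots> = \<i> * of_real pi * f (of_real x)"
      proof (rule contour_integral_unique)
        have "((\<lambda>z. f z / (z - of_real x)) has_contour_integral
            2 * pi * \<i> * winding_number (bernstein_ellipse \<rho>) (of_real x) * f (of_real x)) (bernstein_ellipse \<rho>)"
        proof (rule Cauchy_integral_formula_convex_simple)
          show "path_image (bernstein_ellipse \<rho>) \<subseteq> bernstein_region \<rho> - {of_real x}"
            using \<rho> joukowski_in_bernstein_region[OF \<rho>] joukowski_neq_real[OF x]
            by (auto simp: path_image_bernstein_ellipse)
          show "pathfinish (bernstein_ellipse \<rho>) = pathstart (bernstein_ellipse \<rho>)"
            by (simp add: bernstein_ellipse_eq pathfinish_compose pathstart_compose)
        qed (use \<rho> x f in \<open>auto intro: convex_bernstein_region analytic_imp_holomorphic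
               real_in_interior_bernstein_region valid_path_bernstein_ellipse\<close>)
        from has_contour_integral_div[OF this, of 2]
        show "((\<lambda>z. f z / (z - of_real x) / 2) has_contour_integral \<i> * of_real pi * f (of_real x)) (bernstein_ellipse \<rho>)"
          by (simp add: winding_number_bernstein_ellipse[OF \<rho> x] mult_ac)
      qed
      finally show ?thesis .
    qed
    ultimately have "(\<lambda>k. of_real (gegenbauer k 1 x) * A k) sums (\<i> * of_real pi * f (of_real x))"
      by simp
    from sums_divide[OF this, of "\<i> * of_real pi"] show ?thesis
      by (simp add: scaleR_conv_of_real)
  qed

  let ?h = "gegenbauer_h n lam" and ?c = "c_const n lam"
  note hc = gegenbauer_h_c_const_nonzero[OF l l0, of n]
  define q where "q = (\<lambda>m. pochhammer (real n + 1) m * pochhammer (1 - lam) m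
                            / (pochhammer (real n + lam + 1) m * fact m))"
  have inner: "gegenbauer_inner n lam (n + 2 * m) 1 = ?h * (?c * q m)" for m
    using gegenbauer_inner_Chebyshev[OF l l0, of n m] hc by (simp add: q_def field_simps)

  \<comment> \<open>The expansion is integrated against the weight times C_n; the geometric decay of
    \<open>A k\<close> outweighs the linear growth of C_k^(1).\<close>
  have coeff: "(\<lambda>k. gegenbauer_inner n lam k 1 *\<^sub>R (A k / (\<i> * of_real pi))) sums (of_real ?h * gegenbauer_coeff lam f n)"
  proof -
    let ?g = "\<lambda>k x. (gegenbauer n lam x * gegenbauer k 1 x) *\<^sub>R (A k / (\<i> * of_real pi))"
    have "bounded (gegenbauer n lam ` {-1..1})"
      by (intro compact_imp_bounded compact_continuous_image continuous_intros) auto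
    then obtain b where b: "\<And>x. x \<in> {-1..1} \<Longrightarrow> \<bar>gegenbauer n lam x\<bar> \<le> b"
      unfolding bounded_iff ball_simps real_norm_def by blast
    have b0: "b \<ge> 0" using b[of 0] by auto
    have "(\<lambda>k. integral {-1..1} (\<lambda>x. gegenbauer_weight lam x *\<^sub>R ?g k x)) sums
           integral {-1..1} (\<lambda>x. gegenbauer_weight lam x *\<^sub>R (\<Sum>k. ?g k x))"
    proof (rule integral_gegenbauer_weight_sums[OF l])
      show "summable (\<lambda>k. b * (2 * B) * ((real k + 1) * (1/\<rho>) ^ k))"
        by (intro summable_mult summable_Suc_mult_power small)
      show "continuous_on {-1..1} (?g k)" for k by (intro continuous_intros)
      show "norm (?g k x) \<le> b * (2 * B) * ((real k + 1) * (1/\<rho>) ^ k)" if "x \<in> {-1..1}" for k x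
      proof -
        have "norm (?g k x) = \<bar>gegenbauer n lam x\<bar> * \<bar>gegenbauer k 1 x\<bar> * (norm (A k) / pi)"
          by (simp add: abs_mult norm_divide norm_mult)
        also have "\<dots> \<le> b * (real k + 1) * (2 * pi * B * (1/\<rho>) ^ k / pi)"
          using b[OF that] b0 gegenbauer_one_bound[of x k] that bA[of k]
          by (intro mult_mono divide_right_mono) auto
        finally show ?thesis by (simp add: mult_ac)
      qed
    qed
    moreover have "integral {-1..1} (\<lambda>x. gegenbauer_weight lam x *\<^sub>R ?g k x)
        = gegenbauer_inner n lam k 1 *\<^sub>R (A k / (\<i> * of_real pi))" for k
      using has_integral_scaleR_left[OF has_integral_gegenbauer_inner[OF l], of n k 1 "A k / (\<i> * of_real pi)"]
      by (intro integral_unique) simp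
    moreover have "integral {-1..1} (\<lambda>x. gegenbauer_weight lam x *\<^sub>R (\<Sum>k. ?g k x)) = of_real ?h * gegenbauer_coeff lam f n"
    proof -
      have "integral {-1..1} (\<lambda>x. gegenbauer_weight lam x *\<^sub>R (\<Sum>k. ?g k x)) =
         integral {-1..1} (\<lambda>x. complex_of_real (gegenbauer_weight lam x * gegenbauer n lam x) * f (complex_of_real x))"
      proof (rule integral_cong)
        fix x :: real assume "x \<in> {-1..1}"
        from sums_unique[OF sums_scaleR_right[OF f_sums[OF this], of "gegenbauer n lam x"]]
        have "(\<Sum>k. ?g k x) = gegenbauer n lam x *\<^sub>R f (of_real x)" by simp
        then show "gegenbauer_weight lam x *\<^sub>R (\<Sum>k. ?g k x) =
           complex_of_real (gegenbauer_weight lam x * gegenbauer n lam x) * f (complex_of_real x)"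
          by (simp only: scaleR_conv_of_real of_real_mult mult.assoc)
      qed
      then show ?thesis using hc by (simp add: gegenbauer_coeff_def)
    qed
    ultimately show ?thesis by (simp only:)
  qed
  \<comment> \<open>Only the indices k = n + 2m carry nonzero moments, so the series may be
    reindexed by m.\<close>
  have "strict_mono (\<lambda>m. n + 2 * m)" by (auto simp: strict_mono_def)
  from sums_mono_reindex[OF this, of "\<lambda>k. gegenbauer_inner n lam k 1 *\<^sub>R (A k / (\<i> * of_real pi))"]
  have "(\<lambda>m. gegenbauer_inner n lam (n + 2 * m) 1 *\<^sub>R (A (n + 2 * m) / (\<i> * of_real pi)))
           sums (of_real ?h * gegenbauer_coeff lam f n)"
    using coeff gegenbauer_inner_not_shift[OF l] by simp
  from sums_divide[OF this, of "of_real ?h"]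
  have lhs: "(\<lambda>m. of_real ?c / (\<i> * of_real pi) * (of_real (q m) * A (n + 2 * m))) sums gegenbauer_coeff lam f n"
    unfolding inner using hc by (simp add: scaleR_conv_of_real mult_ac)

  obtain b where b: "\<And>k. \<bar>gegenbauer_inner n lam k 1\<bar> \<le> b * (real k + 1)"
    using gegenbauer_inner_Chebyshev_bound[OF l] by blast
  define b' where "b' = b / \<bar>?h * ?c\<bar>"
  \<comment> \<open>Dividing the moment bound by the nonzero constant h c bounds the hypergeometric
    coefficients.\<close>
  have q_bound: "\<bar>q m\<bar> \<le> b' * (real (n + 2 * m) + 1)" for m
    using b[of "n + 2 * m"] hc unfolding inner b'_def by (simp add: abs_mult field_simps)
  have summ: "summable (\<lambda>m. b' * ((real (n + 2 * m) + 1) * (1/\<rho>) ^ (n + 2 * m)))"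
  proof (rule summable_mult)
    have "inj (\<lambda>m. n + 2 * m)" by (auto simp: inj_def)
    then show "summable (\<lambda>m. (real (n + 2 * m) + 1) * (1/\<rho>) ^ (n + 2 * m))"
      using summable_reindex[OF summable_Suc_mult_power[OF small], of "\<lambda>m. n + 2 * m"] \<rho>
      by (simp add: o_def)
  qed
  have rhs: "(\<lambda>m. of_real (q m) * A (n + 2 * m)) sums
     contour_integral ?C (\<lambda>w. \<Sum>m. of_real (q m) * (F w * inverse w ^ Suc (n + 2 * m)))"
  proof -
    let ?g = "\<lambda>m w. of_real (q m) * (F w * inverse w ^ Suc (n + 2 * m))"
    have "(\<lambda>m. contour_integral ?C (?g m)) sums contour_integral ?C (\<lambda>w. \<Sum>m. ?g m w)"
    proof (rule contour_integral_circlepath_sums)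
      show "summable (\<lambda>m. B * (1/\<rho>) * (b' * ((real (n + 2 * m) + 1) * (1/\<rho>) ^ (n + 2 * m))))"
        by (intro summable_mult[OF summ])
      show "continuous_on (sphere 0 \<rho>) (?g m)" for m
        by (intro continuous_on_mult_left contFw)
      show "norm (?g m w) \<le> B * (1/\<rho>) * (b' * ((real (n + 2 * m) + 1) * (1/\<rho>) ^ (n + 2 * m)))"
        if "w \<in> sphere 0 \<rho>" for m w
      proof -
        have "norm (?g m w) = \<bar>q m\<bar> * norm (F w * inverse w ^ Suc (n + 2 * m))"
          by (simp only: norm_mult norm_of_real)
        also have "\<dots> \<le> (b' * (real (n + 2 * m) + 1)) * (B * (1/\<rho>) ^ Suc (n + 2 * m))"
          by (intro mult_mono Fw q_bound that order_trans[OF abs_ge_zero q_bound]) auto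
        finally show ?thesis by (simp add: mult_ac)
      qed
    qed (use \<rho> in auto)
    moreover have "contour_integral ?C (?g m) = of_real (q m) * A (n + 2 * m)" for m
      unfolding A_def using contFw[of "Suc (n + 2 * m)"] \<rho>
      by (intro contour_integral_lmul contour_integrable_continuous_circlepath) simp
    ultimately show ?thesis by (simp only:)
  qed
  \<comment> \<open>On the circle \<open>joukowski_inv\<close> recovers w, and w^(-n-1) times the
    hypergeometric series in w^(-2) is the series with powers w^(-n-2m-1).\<close>
  have hyp: "(\<Sum>m. of_real (q m) * (F w * inverse w ^ Suc (n + 2 * m))) =
      deriv joukowski w * (f (joukowski w) / (joukowski_inv (joukowski w)) ^ (n + 1) *
           hyp2F1 (of_nat n + 1) (1 - complex_of_real lam) (of_nat n + complex_of_real lam + 1)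
                  (1 / (joukowski_inv (joukowski w))\<^sup>2))" if w: "w \<in> sphere 0 \<rho>" for w
  proof -
    note [simp] = joukowski_inv_joukowski[OF nz(2)[OF w]]
    have poch: "pochhammer (complex_of_real y) m = of_real (pochhammer y m)" for y m
      by (rule pochhammer_of_real)
    have e: "of_nat n + 1 = complex_of_real (real n + 1)" "1 - complex_of_real lam = of_real (1 - lam)"
       "of_nat n + complex_of_real lam + 1 = of_real (real n + lam + 1)" by simp_all
    have "hyp2F1 (of_nat n + 1) (1 - complex_of_real lam) (of_nat n + complex_of_real lam + 1) (1 / w\<^sup>2)
        = (\<Sum>m. of_real (q m) * inverse w ^ (2 * m))"
      unfolding hyp2F1_def e poch q_def
      by (rule suminf_cong) (simp add: power_mult[symmetric] divide_inverse mult_ac power_inverse)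
    moreover have "summable (\<lambda>m. of_real (q m) * inverse w ^ (2 * m))"
    proof (rule summable_comparison_test')
      \<comment> \<open>The factor \<rho>^n undoes the (1/\<rho>)^n in the majorant
        \<open>summ\<close>, leaving (1/\<rho>)^(2m).\<close>
      show "summable (\<lambda>m. \<rho> ^ n * (b' * ((real (n + 2 * m) + 1) * (1/\<rho>) ^ (n + 2 * m))))"
        by (intro summable_mult[OF summ])
      show "norm (of_real (q m) * inverse w ^ (2 * m)) \<le> \<rho> ^ n * (b' * ((real (n + 2 * m) + 1) * (1/\<rho>) ^ (n + 2 * m)))"
        if "m \<ge> 0" for m
      proof -
        have "\<bar>q m\<bar> * (1/\<rho>) ^ (2 * m) \<le> b' * (real (n + 2 * m) + 1) * (1/\<rho>) ^ (2 * m)"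
          using q_bound[of m] \<rho> by (intro mult_right_mono) auto
        then show ?thesis using nz(3)[OF w] \<rho>
          by (simp add: norm_mult norm_power norm_divide inverse_eq_divide power_add power_divide)
      qed
    qed
    from suminf_mult[OF this, of "F w * inverse w ^ Suc n"]
    have "(\<Sum>m. of_real (q m) * (F w * inverse w ^ Suc (n + 2 * m)))
       = F w * inverse w ^ Suc n * (\<Sum>m. of_real (q m) * inverse w ^ (2 * m))"
      by (simp add: power_add mult_ac)
    ultimately show ?thesis
      by (simp add: F_def divide_inverse power_inverse mult_ac)
  qed
  have "contour_integral (bernstein_ellipse \<rho>)
      (\<lambda>z. f z / (joukowski_inv z) ^ (n + 1) *
           hyp2F1 (of_nat n + 1) (1 - complex_of_real lam) (of_nat n + complex_of_real lam + 1)
                  (1 / (joukowski_inv z)\<^sup>2)) =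
     contour_integral ?C (\<lambda>w. \<Sum>m. of_real (q m) * (F w * inverse w ^ Suc (n + 2 * m)))"
    using \<rho> hyp by (subst contour_integral_bernstein_ellipse) (auto intro!: contour_integral_eq)
  \<comment> \<open>The coefficient and the contour integral are limits of the same series in m,
    hence equal.\<close>
  with sums_mult[OF rhs, of "of_real ?c / (\<i> * of_real pi)"] lhs show ?thesis
    using sums_unique2 by fastforce
qed

end
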